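(* Let $A_1,\dots,A_n$ be wqos. Suppose there exist $i\in[1,n]$ such that $\mathbf{o}(A_i)$ is an infinite indecomposable ordinal, and $j_1\ne j_2\in[1,n]$ such that all exponents in the Cantor normal forms of $\mathbf{o}(A_{j_1})$ and $\mathbf{o}(A_{j_2})$ are infinite. Then $\mathbf{w}(A_1\times\dots\times A_n)=\mathbf{o}(A_1)\otimes\dots\otimes\mathbf{o}(A_n)$.
   Context: A wqo is a quasi-order with no infinite bad sequence (a sequence $x_0,x_1,\dots$ is bad if there are no $i<j$ with $x_i\le x_j$). $\mathbf{w}(A)$ (width) is the rank of the forest of nonempty finite sequences of pairwise incomparable elements ordered by initial segment; $\mathbf{o}(A)$ (maximal order type) is the rank of the forest of nonempty finite bad sequences ordered by initial segment (equivalently the maximal order type of a linear extension). An ordinal is infinite indecomposable if it equals $\omega^\beta$ with $\beta\ge1$. Products have the componentwise order; $\otimes$ is the natural (Hessenberg) product. *)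

theory Defs
  imports Main "HOL-Library.Sublist" "HOL-Library.FuncSet"
begin

text \<open>Ordinals of cardinality at most |'x|: well-orders on subsets of 'x modulo isomorphism.\<close>

lemma Well_order_empty_rel: "Well_order ({} :: 'x rel)"
  by (simp add: well_order_on_def linear_order_on_def partial_order_on_def preorder_on_def
      refl_on_def trans_on_def antisym_def total_on_def Field_def wf_on_def)

lemma ordIso_part_equivp: "part_equivp (\<lambda>(r::'x rel) s. (r, s) \<in> ordIso)"
proof (rule part_equivpI)
  show "\<exists>x::'x rel. (x, x) \<in> ordIso"
    using ordIso_reflexive[OF Well_order_empty_rel] by blast
  show "symp (\<lambda>(r::'x rel) s. (r, s) \<in> ordIso)"
    by (auto intro: sympI ordIso_symmetric)
  show "transp (\<lambda>(r::'x rel) s. (r, s) \<in> ordIso)"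
    by (auto intro: transpI ordIso_transitive)
qed

quotient_type 'x ordinal = "'x rel" / partial: "\<lambda>r s. (r, s) \<in> ordIso"
  by (rule ordIso_part_equivp)

lift_definition ord_le :: "'x ordinal \<Rightarrow> 'x ordinal \<Rightarrow> bool"
  is "\<lambda>r s. (r, s) \<in> ordLeq"
  by (meson ordIso_iff_ordLeq ordLeq_transitive)

lemma ordIso_refl_WO: "(r, r) \<in> ordIso \<Longrightarrow> Well_order r"
  by (simp add: ordIso_def)

lemma rep_ordinal_WO: "Well_order (rep_ordinal a)"
  using Quotient3_rep_reflp[OF Quotient3_ordinal] ordIso_refl_WO by blast

lemma ord_le_rep: "ord_le a b \<longleftrightarrow> (rep_ordinal a, rep_ordinal b) \<in> ordLeq"
  by (simp add: ord_le_def)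

lemma ord_le_refl: "ord_le a a"
  by (simp add: ord_le_rep ordLeq_reflexive rep_ordinal_WO)

lemma ord_le_trans: "ord_le a b \<Longrightarrow> ord_le b c \<Longrightarrow> ord_le a c"
  unfolding ord_le_rep using ordLeq_transitive by blast

lemma ord_le_total: "ord_le a b \<or> ord_le b a"
  unfolding ord_le_rep using ordLeq_total rep_ordinal_WO by blast

lemma ord_le_antisym: "ord_le a b \<Longrightarrow> ord_le b a \<Longrightarrow> a = b"
proof -
  assume "ord_le a b" "ord_le b a"
  then have "(rep_ordinal a, rep_ordinal b) \<in> ordIso"
    unfolding ord_le_rep using ordIso_iff_ordLeq by blast
  then show "a = b"
    using Quotient3_rel_rep[OF Quotient3_ordinal] by blast
qed


instantiation ordinal :: (type) linorder
begin
definition less_eq_ordinal :: "'x ordinal \<Rightarrow> 'x ordinal \<Rightarrow> bool" where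
  "less_eq_ordinal = ord_le"
definition less_ordinal :: "'x ordinal \<Rightarrow> 'x ordinal \<Rightarrow> bool" where
  "less_ordinal a b = (ord_le a b \<and> \<not> ord_le b a)"
instance
proof
  fix x y z :: "'x ordinal"
  show "(x < y) = (x \<le> y \<and> \<not> y \<le> x)"
    by (simp add: less_eq_ordinal_def less_ordinal_def)
  show "x \<le> x" by (simp add: less_eq_ordinal_def ord_le_refl)
  show "x \<le> y \<Longrightarrow> y \<le> z \<Longrightarrow> x \<le> z" unfolding less_eq_ordinal_def
    by (rule ord_le_trans)
  show "x \<le> y \<Longrightarrow> y \<le> x \<Longrightarrow> x = y" unfolding less_eq_ordinal_def
    by (rule ord_le_antisym)
  show "x \<le> y \<or> y \<le> x" unfolding less_eq_ordinal_def
    by (rule ord_le_total)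
qed
end

lemma wf_less_ordinal: "wf {(a, b :: 'x ordinal). a < b}"
proof -
  have "{(a, b :: 'x ordinal). a < b} \<subseteq> inv_image ordLess rep_ordinal"
  proof (clarsimp simp: less_ordinal_def)
    fix a b :: "'x ordinal"
    assume "ord_le a b" "\<not> ord_le b a"
    then show "(rep_ordinal a, rep_ordinal b) \<in> ordLess"
      unfolding ord_le_rep using not_ordLeq_iff_ordLess rep_ordinal_WO by blast
  qed
  then show ?thesis using wf_subset wf_inv_image wf_ordLess by blast
qed

instance ordinal :: (type) wellorder
proof
  fix P :: "'x ordinal \<Rightarrow> bool" and a :: "'x ordinal"
  assume "\<And>x. (\<And>y. y < x \<Longrightarrow> P y) \<Longrightarrow> P x"
  then show "P a" using wf_induct[OF wf_less_ordinal, of P] by blast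
qed

definition ozero :: "'x ordinal" where
  "ozero = (LEAST a. True)"

definition osup :: "'x ordinal set \<Rightarrow> 'x ordinal" where
  "osup S = (LEAST a. \<forall>s\<in>S. s \<le> a)"

definition osucc :: "'x ordinal \<Rightarrow> 'x ordinal" where
  "osucc a = (LEAST b. a < b)"

definition oone :: "'x ordinal" where
  "oone = osucc ozero"

definition oomega :: "'x ordinal" where
  "oomega = (LEAST a. ozero < a \<and> (\<forall>b<a. osucc b < a))"

definition oadd :: "'x ordinal \<Rightarrow> 'x ordinal \<Rightarrow> 'x ordinal" where
  "oadd a = wfrec {(x, y). x < y} (\<lambda>f b. osup ({a} \<union> {osucc (f c) | c. c < b}))"

definition omult :: "'x ordinal \<Rightarrow> 'x ordinal \<Rightarrow> 'x ordinal" where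
  "omult a = wfrec {(x, y). x < y} (\<lambda>f b. osup ({ozero} \<union> {oadd (f c) a | c. c < b}))"

definition oexp_omega :: "'x ordinal \<Rightarrow> 'x ordinal" where
  "oexp_omega = wfrec {(x, y). x < y} (\<lambda>f b. osup ({oone} \<union> {omult (f c) oomega | c. c < b}))"

definition cnf_eval :: "'x ordinal list \<Rightarrow> 'x ordinal" where
  "cnf_eval bs = foldr (\<lambda>b acc. oadd (oexp_omega b) acc) bs ozero"

definition cnf :: "'x ordinal \<Rightarrow> 'x ordinal list" where
  "cnf a = (THE bs. sorted_wrt (\<ge>) bs \<and> cnf_eval bs = a)"

definition natural_sum :: "'x ordinal \<Rightarrow> 'x ordinal \<Rightarrow> 'x ordinal" where
  "natural_sum a b = cnf_eval (rev (sort (cnf a @ cnf b)))"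

definition natural_prod :: "'x ordinal \<Rightarrow> 'x ordinal \<Rightarrow> 'x ordinal" where
  "natural_prod a b = cnf_eval (rev (sort [natural_sum x y. x \<leftarrow> cnf a, y \<leftarrow> cnf b]))"

definition infinite_indecomposable :: "'x ordinal \<Rightarrow> bool" where
  "infinite_indecomposable a \<longleftrightarrow> (\<exists>b. oone \<le> b \<and> a = oexp_omega b)"

definition all_cnf_exponents_infinite :: "'x ordinal \<Rightarrow> bool" where
  "all_cnf_exponents_infinite a \<longleftrightarrow> (\<forall>e\<in>set (cnf a). oomega \<le> e)"

definition node_rank :: "'b list set \<Rightarrow> 'b list \<Rightarrow> 'x ordinal" where
  "node_rank F = wfrec {(t, s). t \<in> F \<and> s \<in> F \<and> strict_prefix s t}
     (\<lambda>r s. osup {osucc (r t) | t. t \<in> F \<and> strict_prefix s t})"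

definition forest_rank :: "'b list set \<Rightarrow> 'x ordinal" where
  "forest_rank F = osup {osucc (node_rank F s) | s. s \<in> F}"

definition qo_on :: "'b set \<Rightarrow> ('b \<Rightarrow> 'b \<Rightarrow> bool) \<Rightarrow> bool" where
  "qo_on A le \<longleftrightarrow> (\<forall>x\<in>A. le x x) \<and> (\<forall>x\<in>A. \<forall>y\<in>A. \<forall>z\<in>A. le x y \<longrightarrow> le y z \<longrightarrow> le x z)"

definition wqo_on :: "'b set \<Rightarrow> ('b \<Rightarrow> 'b \<Rightarrow> bool) \<Rightarrow> bool" where
  "wqo_on A le \<longleftrightarrow> qo_on A le \<and>
     (\<forall>f::nat \<Rightarrow> 'b. (\<forall>i. f i \<in> A) \<longrightarrow> (\<exists>i j. i < j \<and> le (f i) (f j)))"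

definition bad_seqs :: "'b set \<Rightarrow> ('b \<Rightarrow> 'b \<Rightarrow> bool) \<Rightarrow> 'b list set" where
  "bad_seqs A le = {xs. xs \<noteq> [] \<and> set xs \<subseteq> A \<and>
     (\<forall>i j. i < j \<and> j < length xs \<longrightarrow> \<not> le (xs ! i) (xs ! j))}"

definition antichain_seqs :: "'b set \<Rightarrow> ('b \<Rightarrow> 'b \<Rightarrow> bool) \<Rightarrow> 'b list set" where
  "antichain_seqs A le = {xs. xs \<noteq> [] \<and> set xs \<subseteq> A \<and>
     (\<forall>i j. i < length xs \<and> j < length xs \<and> i \<noteq> j \<longrightarrow> \<not> le (xs ! i) (xs ! j))}"

definition wqo_width :: "'b set \<Rightarrow> ('b \<Rightarrow> 'b \<Rightarrow> bool) \<Rightarrow> 'x ordinal" where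
  "wqo_width A le = forest_rank (antichain_seqs A le)"

definition wqo_mot :: "'b set \<Rightarrow> ('b \<Rightarrow> 'b \<Rightarrow> bool) \<Rightarrow> 'x ordinal" where
  "wqo_mot A le = forest_rank (bad_seqs A le)"

definition prod_le :: "nat set \<Rightarrow> (nat \<Rightarrow> 'a \<Rightarrow> 'a \<Rightarrow> bool) \<Rightarrow> (nat \<Rightarrow> 'a) \<Rightarrow> (nat \<Rightarrow> 'a) \<Rightarrow> bool" where
  "prod_le I le f g \<longleftrightarrow> (\<forall>i\<in>I. le i (f i) (g i))"

text \<open>Ordinal type large enough for all ordinals occurring in the theorem.\<close>
type_synonym 'a big_ordinal = "((nat \<Rightarrow> 'a) list \<times> nat) ordinal"

end

theory Submission
  imports Defs "HOL-Library.Multiset_Order" "HOL-Library.Infinite_Typeclass"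
begin

text \<open>
  Write \<open>o\<close> and \<open>w\<close> for maximal order type and width. If \<open>o(A) = \<omega>^e\<^sub>1 + \<dots> + \<omega>^e\<^sub>m\<close> in
  Cantor normal form, then \<open>A\<close> splits into pieces \<open>B\<^sub>1, \<dots>, B\<^sub>m\<close> with \<open>o(B\<^sub>p) = \<omega>^e\<^sub>p\<close> such that no element
  of a piece lies below an element of an earlier piece: some residual \<open>D\<close> of \<open>A\<close> has type
  \<open>\<omega>^e\<^sub>1 + \<dots> + \<omega>^e\<^sub>m\<^sub>-\<^sub>1\<close>, and \<open>o(D) + o(A - D) \<le> o(A) \<le> o(D) \<oplus> o(A - D)\<close> determines \<open>o(A - D)\<close>.

  Upper bound: \<open>w \<le> o\<close>, and for pieces of types \<open>\<omega>^b\<^sub>k\<close> the elements of the product not above a given one lie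
  in finitely many products of pieces in which one exponent has dropped, so by induction the product has
  type at most \<open>\<omega>^(b\<^sub>1 \<oplus> \<dots> \<oplus> b\<^sub>n)\<close>. Subadditivity and distributivity give the general case.

  Lower bound: play the products of pieces one after another, in increasing order of exponents. In the
  coordinate with indecomposable infinite type one can always move up to elements that are not below any
  of the finitely many elements played so far, while another coordinate moves to an earlier piece, so
  everything stays incomparable. The same trick inside a single product of pieces shows by induction on
  the exponents that its width is at least \<open>\<omega>^(c\<^sub>1 \<oplus> \<dots> \<oplus> c\<^sub>n)\<close> when two of the exponents are
  \<open>1 + c\<^sub>k\<close> and the others are \<open>c\<^sub>k\<close>; and \<open>1 + c = c\<close> for infinite \<open>c\<close>.
\<close>

section \<open>Ordinal arithmetic\<close>

unbundle cardinal_syntax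

text \<open>\<open>osup\<close> is a \<open>LEAST\<close> over upper bounds, so it is a true
  supremum only where an upper bound exists. Sets of at most as many ordinals as \<open>'x\<close>
  has elements are bounded once \<open>'x\<close> is infinite.\<close>

definition small :: "'x ordinal set \<Rightarrow> bool" where
  "small S \<longleftrightarrow> |S| \<le>o |UNIV :: 'x set|"

lemma less_ordinal_iff_ordLess: "a < b \<longleftrightarrow> rep_ordinal a <o rep_ordinal b"
  unfolding less_ordinal_def ord_le_rep
  using not_ordLeq_iff_ordLess rep_ordinal_WO ordLess_imp_ordLeq by blast

lemma rep_ordinal_ordIso_eq: "rep_ordinal a =o rep_ordinal b \<Longrightarrow> a = b"
  using Quotient3_rel_rep[OF Quotient3_ordinal] by blast

lemma rep_abs_ordinal: "Well_order r \<Longrightarrow> rep_ordinal (abs_ordinal r) =o r"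
  using Quotient3_rep_abs[OF Quotient3_ordinal] ordIso_reflexive by blast

text \<open>Each \<open>b < a\<close> goes to the point of \<open>rep_ordinal a\<close> that cuts
  off an initial segment of type \<open>b\<close>; equal points give isomorphic segments, so the map
  is injective.\<close>

lemma small_lessThan: "small {..<a :: 'x ordinal}"
proof -
  let ?r = "rep_ordinal a"
  have "\<exists>x. rep_ordinal b =o Restr ?r (underS ?r x)" if "b < a" for b
    using that ordLess_iff_ordIso_Restr[OF rep_ordinal_WO[of a] rep_ordinal_WO[of b]]
    unfolding less_ordinal_iff_ordLess by blast
  then obtain f where f: "\<And>b. b < a \<Longrightarrow> rep_ordinal b =o Restr ?r (underS ?r (f b))"
    by metis
  have "inj_on f {..<a}"
  proof (rule inj_onI)
    fix b c assume "b \<in> {..<a}" "c \<in> {..<a}" "f b = f c"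
    then have "rep_ordinal b =o rep_ordinal c"
      using f ordIso_symmetric ordIso_transitive by (metis lessThan_iff)
    then show "b = c" by (rule rep_ordinal_ordIso_eq)
  qed
  then show ?thesis
    unfolding small_def using card_of_ordLeq[of "{..<a}" "UNIV :: 'x set"] by blast
qed

lemma small_image: "small S \<Longrightarrow> small (f ` S)" for f :: "'x ordinal \<Rightarrow> 'x ordinal"
  unfolding small_def using card_of_image ordLeq_transitive by blast

lemma small_Un: "small S \<Longrightarrow> small T \<Longrightarrow> small (S \<union> T :: 'x::infinite ordinal set)"
  unfolding small_def
  using card_of_Un_ordLeq_infinite_Field[of "|UNIV :: 'x set|" S T] infinite_UNIV[where 'a='x]
    card_of_card_order_on[of "UNIV :: 'x set"]
  by (simp add: Field_card_of)

lemma small_finite: "finite S \<Longrightarrow> small (S :: 'x::infinite ordinal set)"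
  unfolding small_def
  using infinite_UNIV finite_ordLess_infinite[OF card_of_Well_order card_of_Well_order,
      of S "UNIV :: 'x set"] ordLess_imp_ordLeq
  by (metis Field_card_of)

lemma strict_mono_wellorder_ge:
  fixes f :: "'a::wellorder \<Rightarrow> 'a"
  assumes "\<And>x y. x < y \<Longrightarrow> f x < f y"
  shows "x \<le> f x"
proof (induction x rule: less_induct)
  case (less x)
  then show ?case using assms by (metis leD leI)
qed

text \<open>Burali-Forti: an injection into \<open>'x\<close> would transport the order of all
  ordinals to part of \<open>'x\<close>, so their type would be an ordinal over \<open>'x\<close>,
  no larger than one of its own proper initial segments.\<close>

lemma not_small_UNIV: "\<not> small (UNIV :: 'x ordinal set)"
proof
  assume "small (UNIV :: 'x ordinal set)"
  then obtain f :: "'x ordinal \<Rightarrow> 'x" where f: "inj f"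
    unfolding small_def using card_of_ordLeq[of "UNIV :: 'x ordinal set" "UNIV :: 'x set"] by blast
  define R where "R = {(f a, f b) | a b. a \<le> b}"
  have R: "(f a, f b) \<in> R \<longleftrightarrow> a \<le> b" for a b
    using f by (auto simp: R_def inj_def)
  have Fld: "Field R = range f"
    by (auto simp: R_def Field_def)
  have wo: "Well_order R"
    unfolding well_order_on_def linear_order_on_def partial_order_on_def preorder_on_def
  proof (intro conjI)
    show "R \<subseteq> Field R \<times> Field R" by (auto simp: Field_def)
    show "refl_on (Field R) R" unfolding refl_on_def Fld by (auto simp: R)
    show "trans R" using f by (fastforce simp: R_def trans_def inj_def)
    show "antisym R" using f by (auto simp: R_def antisym_def inj_def) (metis order.antisym)
    show "total_on (Field R) R" unfolding Fld total_on_def by (auto simp: R)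
    have "wf (inv_image {(a, b :: 'x ordinal). a < b} (inv f))"
      by (rule wf_inv_image[OF wf_less_ordinal])
    then show "wf (R - Id)"
      by (rule wf_subset) (use f in \<open>auto simp: R_def\<close>)
  qed
  \<comment> \<open>\<open>\<phi> c\<close> is the type of the copy of the ordinals below
    \<open>c\<close>. Strict monotonicity alone gives \<open>c \<le> \<phi> c\<close>, which is
    contradicted at the type of \<open>R\<close>.\<close>
  define \<phi> :: "'x ordinal \<Rightarrow> 'x ordinal" where "\<phi> c = abs_ordinal (Restr R (underS R (f c)))" for c
  have uS: "underS R (f c) = f ` {..<c}" for c
  proof (intro set_eqI iffI)
    fix y assume y: "y \<in> underS R (f c)"
    then obtain b where b: "y = f b" by (auto simp: underS_def R_def)
    then have "b \<le> c" "b \<noteq> c" using y R by (auto simp: underS_def)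
    then show "y \<in> f ` {..<c}" using b by auto
  next
    fix y assume "y \<in> f ` {..<c}"
    then show "y \<in> underS R (f c)" using f R by (auto simp: underS_def inj_def)
  qed
  have wor: "Well_order (Restr R X)" for X by (rule Well_order_Restr[OF wo])
  have repphi: "rep_ordinal (\<phi> c) =o Restr R (underS R (f c))" for c
    unfolding \<phi>_def by (rule rep_abs_ordinal[OF wor])
  have wr: "wo_rel R" using wo by (simp add: wo_rel_def)
  have mono: "\<phi> c < \<phi> d" if "c < d" for c d
  proof -
    have "c \<in> {..<d}" "c \<notin> {..<c}" "{..<c} \<subseteq> {..<d}" using that by auto
    then have "f c \<in> f ` {..<d}" "f c \<notin> f ` {..<c}" "f ` {..<c} \<subseteq> f ` {..<d}"
      using f by (auto simp: inj_def)
    then have "underS R (f c) < underS R (f d)" unfolding uS by blast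
    then have "Restr R (underS R (f c)) <o Restr R (underS R (f d))"
      using ofilter_subset_ordLess[OF wo wo_rel.underS_ofilter[OF wr] wo_rel.underS_ofilter[OF wr]]
      by blast
    then show ?thesis
      unfolding less_ordinal_iff_ordLess
      using repphi ordIso_ordLess_trans ordLess_ordIso_trans ordIso_symmetric by meson
  qed
  let ?O = "abs_ordinal R"
  have "Restr R (underS R (f ?O)) <o R"
    using underS_Restr_ordLess[OF wo] Fld by blast
  then have "\<phi> ?O < ?O"
    unfolding less_ordinal_iff_ordLess
    using repphi rep_abs_ordinal[OF wo] ordIso_ordLess_trans ordLess_ordIso_trans ordIso_symmetric
    by meson
  moreover have "?O \<le> \<phi> ?O" by (rule strict_mono_wellorder_ge[OF mono])
  ultimately show False by simp
qed

text \<open>Otherwise every ordinal would lie at or below a member of \<open>S\<close>, and the set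
  of all ordinals would be a small union of small initial segments.\<close>

lemma small_bounded:
  fixes S :: "'x::infinite ordinal set"
  assumes "small S"
  shows "\<exists>b. \<forall>s\<in>S. s < b"
proof (rule ccontr)
  assume "\<nexists>b. \<forall>s\<in>S. s < b"
  then have "(UNIV :: 'x ordinal set) = (\<Union>s\<in>S. {..<s} \<union> {s})"
    by (auto simp: not_less) (metis order_le_less)
  moreover have "|\<Union>s\<in>S. {..<s} \<union> {s}| \<le>o |UNIV :: 'x set|"
  proof (rule card_of_UNION_ordLeq_infinite)
    show "\<forall>s\<in>S. |{..<s} \<union> {s}| \<le>o |UNIV :: 'x set|"
      using small_Un[OF small_lessThan small_finite] unfolding small_def by blast
  qed (use assms infinite_UNIV in \<open>auto simp: small_def\<close>)
  ultimately show False using not_small_UNIV unfolding small_def by metis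
qed

lemma osup_le_iff:
  fixes S :: "'x::infinite ordinal set"
  assumes "small S"
  shows "osup S \<le> a \<longleftrightarrow> (\<forall>s\<in>S. s \<le> a)"
proof -
  obtain b where "\<forall>s\<in>S. s \<le> b" using small_bounded[OF assms] less_imp_le by blast
  then have "\<forall>s\<in>S. s \<le> osup S" unfolding osup_def by (rule LeastI)
  then show ?thesis
    unfolding osup_def by (auto intro: Least_le order_trans)
qed

lemma less_osup_iff:
  fixes S :: "'x::infinite ordinal set"
  assumes "small S"
  shows "a < osup S \<longleftrightarrow> (\<exists>s\<in>S. a < s)"
  using osup_le_iff[OF assms, of a] by (auto simp: not_le[symmetric])

lemma osucc_le_iff: "osucc (a :: 'x::infinite ordinal) \<le> b \<longleftrightarrow> a < b"
proof -
  obtain c where "a < c" using small_bounded[OF small_finite, of "{a}"] by blast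
  then have "a < osucc a" unfolding osucc_def by (rule LeastI)
  then show ?thesis unfolding osucc_def by (auto intro: Least_le)
qed

lemma less_osucc_iff: "b < osucc (a :: 'x::infinite ordinal) \<longleftrightarrow> b \<le> a"
  using osucc_le_iff[of a b] by auto

lemma ozero_le [simp]: "ozero \<le> a"
  unfolding ozero_def by (simp add: Least_le)

lemma not_less_ozero [simp]: "\<not> a < ozero"
  by (simp add: not_less)

lemma le_ozero_iff [simp]: "a \<le> ozero \<longleftrightarrow> a = ozero"
  by (simp add: order.antisym)

lemma ozero_less_iff: "ozero < a \<longleftrightarrow> a \<noteq> ozero"
  by (auto simp: order_less_le)

lemma less_oone_iff [simp]: "a < (oone :: 'x::infinite ordinal) \<longleftrightarrow> a = ozero"
  by (simp add: oone_def less_osucc_iff)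

lemma oone_le_iff: "(oone :: 'x::infinite ordinal) \<le> a \<longleftrightarrow> a \<noteq> ozero"
  by (simp add: oone_def osucc_le_iff ozero_less_iff)

section \<open>Ordinary sum, product and powers of omega\<close>

lemma small_image_less: "small {f c | c. c < b}" for f :: "'x ordinal \<Rightarrow> 'x ordinal"
proof -
  have "{f c | c. c < b} = f ` {..<b}" by auto
  then show ?thesis by (simp add: small_image small_lessThan)
qed

lemma oadd_rec: "oadd a b = osup ({a} \<union> {osucc (oadd a c) | c. c < b})"
proof -
  have "oadd a b = osup ({a} \<union> {osucc (cut (oadd a) {(x, y). x < y} b c) | c. c < b})"
    unfolding oadd_def by (subst wfrec[OF wf_less_ordinal]) blast
  also have "{osucc (cut (oadd a) {(x, y). x < y} b c) | c. c < b} = {osucc (oadd a c) | c. c < b}"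
    by (auto simp: cut_apply) (metis case_prodI cut_apply mem_Collect_eq)
  finally show ?thesis .
qed

lemma omult_rec: "omult a b = osup ({ozero} \<union> {oadd (omult a c) a | c. c < b})"
proof -
  have "omult a b = osup ({ozero} \<union> {oadd (cut (omult a) {(x, y). x < y} b c) a | c. c < b})"
    unfolding omult_def by (subst wfrec[OF wf_less_ordinal]) blast
  also have "{oadd (cut (omult a) {(x, y). x < y} b c) a | c. c < b} = {oadd (omult a c) a | c. c < b}"
    by (auto simp: cut_apply) (metis case_prodI cut_apply mem_Collect_eq)
  finally show ?thesis .
qed

lemma oexp_omega_rec: "oexp_omega b = osup ({oone} \<union> {omult (oexp_omega c) oomega | c. c < b})"
proof -
  have "oexp_omega b = osup ({oone} \<union> {omult (cut oexp_omega {(x, y). x < y} b c) oomega | c. c < b})"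
    unfolding oexp_omega_def by (subst wfrec[OF wf_less_ordinal]) blast
  also have "{omult (cut oexp_omega {(x, y). x < y} b c) oomega | c. c < b}
      = {omult (oexp_omega c) oomega | c. c < b}"
    by (auto simp: cut_apply) (metis case_prodI cut_apply mem_Collect_eq)
  finally show ?thesis .
qed

text \<open>Turns the recursion into a description of the ordinals below a sum; later equalities
  compare lower sets, with no split into successors and limits.\<close>

lemma less_oadd_iff:
  "d < oadd a (b :: 'x::infinite ordinal) \<longleftrightarrow> d < a \<or> (\<exists>c<b. d \<le> oadd a c)"
proof -
  have "small ({a} \<union> {osucc (oadd a c) | c. c < b})"
    by (intro small_Un small_finite small_image_less) simp
  then show ?thesis
    by (subst oadd_rec) (auto simp: less_osup_iff less_osucc_iff)
qed

lemma less_omult_iff: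
  "d < omult a (b :: 'x::infinite ordinal) \<longleftrightarrow> (\<exists>c<b. d < oadd (omult a c) a)"
proof -
  have "small ({ozero} \<union> {oadd (omult a c) a | c. c < b})"
    by (intro small_Un small_finite small_image_less) simp
  then show ?thesis
    by (subst omult_rec) (auto simp: less_osup_iff)
qed

lemma less_oexp_omega_iff:
  "d < oexp_omega (b :: 'x::infinite ordinal) \<longleftrightarrow> d = ozero \<or> (\<exists>c<b. d < omult (oexp_omega c) oomega)"
proof -
  have "small ({oone} \<union> {omult (oexp_omega c) oomega | c. c < b})"
    by (intro small_Un small_finite small_image_less) simp
  then show ?thesis
    by (subst oexp_omega_rec) (auto simp: less_osup_iff)
qed

lemma oadd_less_mono: "b < c \<Longrightarrow> oadd a b < oadd a (c :: 'x::infinite ordinal)"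
  using less_oadd_iff by blast

lemma oadd_less_iff [simp]: "oadd a b < oadd a (c :: 'x::infinite ordinal) \<longleftrightarrow> b < c"
  by (metis oadd_less_mono linorder_less_linear order_less_asym)

lemma oadd_le_iff [simp]: "oadd a b \<le> oadd a (c :: 'x::infinite ordinal) \<longleftrightarrow> b \<le> c"
  by (simp add: not_less[symmetric])

lemma oadd_ozero [simp]: "oadd a (ozero :: 'x::infinite ordinal) = a"
  using less_oadd_iff[of _ a ozero] by (metis not_less_ozero linorder_less_linear order_less_irrefl)

lemma le_oadd_left: "a \<le> oadd a (b :: 'x::infinite ordinal)"
  using less_oadd_iff by (metis not_le_imp_less order_less_irrefl)

lemma le_oadd_right: "b \<le> oadd a (b :: 'x::infinite ordinal)"
  by (rule strict_mono_wellorder_ge) simp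

lemma ozero_oadd [simp]: "oadd ozero b = (b :: 'x::infinite ordinal)"
proof (induction b rule: less_induct)
  case (less b)
  then have "d < oadd ozero b \<longleftrightarrow> d < b" for d
    using less_oadd_iff[of d ozero b] by auto
  then show ?case by (metis linorder_less_linear order_less_irrefl)
qed

lemma oadd_mono_left: "a \<le> a' \<Longrightarrow> oadd a b \<le> oadd a' (b :: 'x::infinite ordinal)"
proof (induction b rule: less_induct)
  case (less b)
  have "d < oadd a' b" if "d < oadd a b" for d
    using that less unfolding less_oadd_iff[of d] by (metis order_less_le_trans order_trans)
  then show ?case using linorder_not_less by blast
qed

lemma oadd_mono: "a \<le> a' \<Longrightarrow> b \<le> b' \<Longrightarrow> oadd a b \<le> oadd a' (b' :: 'x::infinite ordinal)"
  using oadd_mono_left oadd_le_iff order_trans by blast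

lemma oadd_assoc: "oadd (oadd a b) c = oadd a (oadd b (c :: 'x::infinite ordinal))"
proof (induction c rule: less_induct)
  case (less c)
  have "d < oadd (oadd a b) c \<longleftrightarrow> d < oadd a (oadd b c)" for d
  proof -
    have "d < oadd (oadd a b) c \<longleftrightarrow> d < oadd a b \<or> (\<exists>c'<c. d \<le> oadd a (oadd b c'))"
      using less by (auto simp: less_oadd_iff[of d "oadd a b"])
    also have "\<dots> \<longleftrightarrow> d < oadd a (oadd b c)"
      (is "?l \<longleftrightarrow> ?r")
    proof
      assume ?l then show ?r
        by (meson oadd_le_iff le_oadd_left oadd_less_mono order_le_less_trans order_less_le_trans)
    next
      assume ?r
      then consider "d < a" | e where "e < oadd b c" "d \<le> oadd a e"
        unfolding less_oadd_iff[of d a "oadd b c"] by blast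
      then show ?l
      proof cases
        case 1 then show ?thesis using le_oadd_left order_less_le_trans by blast
      next
        case 2
        then show ?thesis
          unfolding less_oadd_iff[of e b c]
          by (meson oadd_le_iff oadd_less_mono order_le_less_trans order_trans)
      qed
    qed
    finally show ?thesis .
  qed
  then show ?case by (metis linorder_less_linear order_less_irrefl)
qed

text \<open>The least \<open>d\<close> at which \<open>oadd a d\<close> reaches \<open>c\<close>
  cannot overshoot, since the recursion would then provide a smaller one.\<close>

lemma oadd_diff_exists:
  assumes "a \<le> (c :: 'x::infinite ordinal)"
  shows "\<exists>d. c = oadd a d"
proof -
  let ?d = "LEAST d. c \<le> oadd a d"
  have le: "c \<le> oadd a ?d" using le_oadd_right by (rule LeastI)
  have "\<not> c < oadd a ?d"
  proof
    assume "c < oadd a ?d"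
    then obtain d' where "d' < ?d" "c \<le> oadd a d'"
      using assms unfolding less_oadd_iff by (auto simp: not_less[symmetric])
    then show False using not_less_Least by blast
  qed
  then show ?thesis using le by force
qed

text \<open>The \<open>LEAST\<close> in \<open>oomega\<close> ranges over a nonempty set: countable
  sets are small, so the finite ordinals have a supremum, and it is closed under successor.\<close>

lemma oomega_props:
  "ozero < (oomega :: 'x::infinite ordinal)" "b < (oomega :: 'x::infinite ordinal) \<Longrightarrow> osucc b < oomega"
proof -
  define S :: "'x ordinal set" where "S = range (\<lambda>n. (osucc ^^ n) ozero)"
  obtain g :: "nat \<Rightarrow> 'x" where g: "inj g"
    using infinite_countable_subset[OF infinite_UNIV] by blast
  have "|S| \<le>o |UNIV :: nat set|" unfolding S_def by (rule card_of_image)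
  moreover have "|UNIV :: nat set| \<le>o |UNIV :: 'x set|"
    using g card_of_ordLeq[of "UNIV :: nat set" "UNIV :: 'x set"] by blast
  ultimately have "small S" unfolding small_def using ordLeq_transitive by blast
  note lim = less_osup_iff[OF this]
  have "ozero < osup S"
    unfolding lim using less_osucc_iff[of ozero "ozero :: 'x ordinal"]
    by (auto simp: S_def intro!: exI[of _ 1])
  moreover have "osucc b < osup S" if b: "b < osup S" for b
  proof -
    obtain n where "b < (osucc ^^ n) ozero" using b unfolding lim by (auto simp: S_def)
    then have "osucc b < (osucc ^^ (Suc n)) ozero" by (simp add: less_osucc_iff osucc_le_iff)
    then show ?thesis unfolding lim by (metis S_def rangeI)
  qed
  ultimately have "ozero < osup S \<and> (\<forall>b. b < osup S \<longrightarrow> osucc b < osup S)" by blast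
  then have "ozero < (oomega :: 'x ordinal) \<and> (\<forall>b. b < oomega \<longrightarrow> osucc b < (oomega :: 'x ordinal))"
    unfolding oomega_def by (rule LeastI)
  then show "ozero < (oomega :: 'x::infinite ordinal)"
    and "b < (oomega :: 'x::infinite ordinal) \<Longrightarrow> osucc b < oomega" by blast+
qed

text \<open>By minimality of \<open>oomega\<close>, a smaller nonzero ordinal is not closed under
  successor, hence is a successor itself.\<close>

lemma less_oomegaE:
  assumes "b < (oomega :: 'x::infinite ordinal)"
  obtains n where "b = (osucc ^^ n) ozero"
proof -
  have "\<exists>n. b = (osucc ^^ n) ozero"
    using assms
  proof (induction b rule: less_induct)
    case (less b)
    have "\<not> (ozero < b \<and> (\<forall>c<b. osucc c < b))"
      using less.prems not_less_Least unfolding oomega_def by blast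
    then consider "b = ozero" | c where "c < b" "b \<le> osucc c"
      by (auto simp: not_less)
    then show ?case
    proof cases
      case 1 then show ?thesis by (auto intro: exI[of _ 0])
    next
      case 2
      then have "b = osucc c" using osucc_le_iff[of c b] by auto
      moreover obtain n where "c = (osucc ^^ n) ozero"
        using less.IH[OF 2(1)] 2(1) less.prems by fastforce
      ultimately have "b = (osucc ^^ Suc n) ozero" by simp
      then show ?thesis by blast
    qed
  qed
  then show ?thesis using that by blast
qed

lemma finite_ordinal_less_oomega: "(osucc ^^ n) ozero < (oomega :: 'x::infinite ordinal)"
  by (induction n) (auto intro: oomega_props)

section \<open>Finite multiples and indecomposability of powers of omega\<close>

lemma omult_ozero [simp]: "omult a (ozero :: 'x::infinite ordinal) = ozero"
  using less_omult_iff[of ozero a ozero] by (auto simp: ozero_less_iff)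

lemma omult_osucc: "omult a (osucc b) = oadd (omult a (b :: 'x::infinite ordinal)) a"
proof -
  have mono: "omult a c \<le> omult a b" if "c \<le> b" for c
    using less_omult_iff[of _ a c] less_omult_iff[of _ a b] that
    by (meson leI order_less_irrefl order_less_le_trans)
  have "d < omult a (osucc b) \<longleftrightarrow> d < oadd (omult a b) a" for d
    unfolding less_omult_iff[of d a "osucc b"] less_osucc_iff
    using mono oadd_mono_left order_less_le_trans by blast
  then show ?thesis by (metis linorder_less_linear order_less_irrefl)
qed

lemma omult_finite_add:
  "omult a ((osucc ^^ (m + n)) (ozero :: 'x::infinite ordinal))
    = oadd (omult a ((osucc ^^ m) ozero)) (omult a ((osucc ^^ n) ozero))"
  by (induction n) (simp_all add: omult_osucc oadd_assoc)

lemma less_omult_oomega_iff: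
  "d < omult a (oomega :: 'x::infinite ordinal) \<longleftrightarrow> (\<exists>n. d < omult a ((osucc ^^ n) ozero))"
proof
  assume "d < omult a oomega"
  then obtain c where c: "c < oomega" "d < oadd (omult a c) a"
    unfolding less_omult_iff by blast
  obtain n where "c = (osucc ^^ n) ozero" using c(1) by (rule less_oomegaE)
  then have "d < omult a ((osucc ^^ Suc n) ozero)" using c by (simp add: omult_osucc)
  then show "\<exists>n. d < omult a ((osucc ^^ n) ozero)" by blast
next
  assume "\<exists>n. d < omult a ((osucc ^^ n) ozero)"
  then obtain n where "d < omult a ((osucc ^^ n) ozero)" by blast
  then have "d < oadd (omult a ((osucc ^^ n) ozero)) a"
    using le_oadd_left order_less_le_trans by blast
  then show "d < omult a oomega"
    unfolding less_omult_iff[of d a oomega] using finite_ordinal_less_oomega by blast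
qed

lemma less_oexp_omegaE:
  assumes "d < oexp_omega (b :: 'x::infinite ordinal)"
  obtains "d = ozero" | c n where "c < b" "d < omult (oexp_omega c) ((osucc ^^ n) ozero)"
  using assms unfolding less_oexp_omega_iff[of d] less_omult_oomega_iff by blast

lemma oexp_omega_pos [simp]: "ozero < oexp_omega (b :: 'x::infinite ordinal)"
  by (simp add: less_oexp_omega_iff[of ozero])

lemma omult_finite_less_oexp_omega:
  assumes "c < (b :: 'x::infinite ordinal)"
  shows "omult (oexp_omega c) ((osucc ^^ n) ozero) < oexp_omega b"
proof -
  have "omult (oexp_omega c) ((osucc ^^ n) ozero) < omult (oexp_omega c) ((osucc ^^ Suc n) ozero)"
    using oadd_less_mono[OF oexp_omega_pos, of "omult (oexp_omega c) ((osucc ^^ n) ozero)" c]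
    by (simp add: omult_osucc)
  then show ?thesis
    using assms unfolding less_oexp_omega_iff[of _ b] less_omult_oomega_iff by blast
qed

lemma oexp_omega_less_mono: "c < b \<Longrightarrow> oexp_omega c < oexp_omega (b :: 'x::infinite ordinal)"
  using omult_finite_less_oexp_omega[of c b 1] by (simp add: omult_osucc)

lemma oexp_omega_less_iff [simp]:
  "oexp_omega c < oexp_omega b \<longleftrightarrow> c < (b :: 'x::infinite ordinal)"
  by (metis oexp_omega_less_mono linorder_less_linear order_less_asym)

lemma oexp_omega_le_iff [simp]:
  "oexp_omega c \<le> oexp_omega b \<longleftrightarrow> c \<le> (b :: 'x::infinite ordinal)"
  by (simp add: not_less[symmetric])

lemma omult_finite_mono:
  "a \<le> b \<Longrightarrow> omult a ((osucc ^^ n) ozero) \<le> omult b ((osucc ^^ n) (ozero :: 'x::infinite ordinal))"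
  by (induction n) (simp_all add: omult_osucc oadd_mono)

text \<open>Both arguments lie below finite multiples of one power with exponent below
  \<open>b\<close>, and such multiples add up to another one.\<close>

lemma oadd_less_oexp_omega:
  assumes "x < oexp_omega b" "y < oexp_omega (b :: 'x::infinite ordinal)"
  shows "oadd x y < oexp_omega b"
proof (cases "x = ozero \<or> y = ozero")
  case True
  then show ?thesis using assms by auto
next
  case False
  obtain c m where c: "c < b" "x < omult (oexp_omega c) ((osucc ^^ m) ozero)"
    using assms(1) False by (auto elim: less_oexp_omegaE)
  obtain d n where d: "d < b" "y < omult (oexp_omega d) ((osucc ^^ n) ozero)"
    using assms(2) False by (auto elim: less_oexp_omegaE)
  let ?e = "oexp_omega (max c d)"
  have "x \<le> omult ?e ((osucc ^^ m) ozero)" "y \<le> omult ?e ((osucc ^^ n) ozero)"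
    using c(2) d(2) omult_finite_mono[of "oexp_omega c" ?e m] omult_finite_mono[of "oexp_omega d" ?e n]
    by auto
  then have "oadd x y \<le> omult ?e ((osucc ^^ (m + n)) ozero)"
    unfolding omult_finite_add by (rule oadd_mono)
  also have "\<dots> < oexp_omega b" using c d by (intro omult_finite_less_oexp_omega) auto
  finally show ?thesis .
qed

lemma le_oexp_omega: "b \<le> oexp_omega (b :: 'x::infinite ordinal)"
  by (rule strict_mono_wellorder_ge) simp

lemma oexp_omega_ozero [simp]: "oexp_omega (ozero :: 'x::infinite ordinal) = oone"
proof -
  have "d < oexp_omega ozero \<longleftrightarrow> d < (oone :: 'x ordinal)" for d
    by (simp add: less_oexp_omega_iff)
  then show ?thesis by (metis linorder_less_linear order_less_irrefl)
qed

text \<open>\<open>1 + omega = omega\<close> because \<open>1 + n\<close> stays finite, and an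
  infinite \<open>c\<close> starts with omega. This absorbs the extra 1 that the lower bound
  requires in two exponents.\<close>

lemma oone_oadd_infinite:
  assumes "oomega \<le> (c :: 'x::infinite ordinal)"
  shows "oadd oone c = c"
proof -
  have "(oadd oone oomega :: 'x ordinal) \<le> oomega"
  proof (rule ccontr)
    assume "\<not> (oadd oone oomega :: 'x ordinal) \<le> oomega"
    then have *: "(oomega :: 'x ordinal) < oadd oone oomega" by simp
    have "\<not> (oomega :: 'x ordinal) < oone" using oomega_props(1) by (simp add: not_less oone_def osucc_le_iff)
    then obtain b :: "'x ordinal" where b: "b < oomega" "oomega \<le> oadd oone b"
      using * unfolding less_oadd_iff[of oomega oone] by blast
    obtain n where n: "b = (osucc ^^ n) ozero" using b(1) by (rule less_oomegaE)
    have "oadd oone ((osucc ^^ n) (ozero :: 'x ordinal)) < oomega"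
    proof (induction n)
      case 0
      then show ?case using oomega_props(2)[OF oomega_props(1)] by (simp add: oone_def)
    next
      case (Suc n)
      have "oadd oone (osucc d) \<le> osucc (oadd oone d)" for d :: "'x ordinal"
      proof (rule leI, rule notI)
        assume "osucc (oadd oone d) < oadd oone (osucc d)"
        then consider "osucc (oadd oone d) < oone" | c where "c \<le> d" "osucc (oadd oone d) \<le> oadd oone c"
          unfolding less_oadd_iff[of _ oone "osucc d"] less_osucc_iff by blast
        then show False
        proof cases
          case 1
          then have "osucc (oadd oone d) \<le> ozero" by simp
          then show ?thesis unfolding osucc_le_iff by simp
        qed (simp add: osucc_le_iff)
      qed
      then show ?case using oomega_props(2)[OF Suc] order_le_less_trans by fastforce
    qed
    then show False using b n by simp
  qed
  then have "(oadd oone oomega :: 'x ordinal) = oomega"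
    using le_oadd_right order.antisym by blast
  moreover obtain d where "c = oadd oomega d" using oadd_diff_exists[OF assms] by blast
  ultimately show ?thesis by (metis oadd_assoc)
qed

section \<open>Cantor normal forms as multisets and natural operations\<close>

text \<open>With exponents kept as a multiset, the order of ordinals becomes the multiset order and
  the natural sum becomes multiset union.\<close>

definition of_cnf :: "'x::infinite ordinal multiset \<Rightarrow> 'x ordinal" where
  "of_cnf M = cnf_eval (rev (sorted_list_of_multiset M))"

lemma cnf_eval_Nil [simp]: "cnf_eval [] = ozero"
  by (simp add: cnf_eval_def)

lemma cnf_eval_Cons [simp]: "cnf_eval (b # bs) = oadd (oexp_omega b) (cnf_eval bs)"
  by (simp add: cnf_eval_def)

lemma cnf_eval_append:
  "cnf_eval (xs @ ys) = oadd (cnf_eval xs) (cnf_eval (ys :: 'x::infinite ordinal list))"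
  by (induction xs) (simp_all add: oadd_assoc)

lemma of_cnf_empty [simp]: "of_cnf {#} = ozero"
  by (simp add: of_cnf_def)

lemma of_cnf_single: "of_cnf {#e#} = oexp_omega e"
  by (simp add: of_cnf_def)

lemma of_cnf_add_max:
  assumes "\<forall>x\<in>#M. x \<le> m"
  shows "of_cnf (add_mset m M) = oadd (oexp_omega m) (of_cnf M)"
proof -
  have "sorted_list_of_multiset (add_mset m M) = sorted_list_of_multiset M @ [m]"
    using assms by (simp add: sorted_insort_is_snoc)
  then show ?thesis by (simp add: of_cnf_def)
qed

lemma of_cnf_add_min:
  assumes "\<forall>x\<in>#M. m \<le> x"
  shows "of_cnf (add_mset m M) = oadd (of_cnf M) (oexp_omega m)"
proof -
  have "sorted_list_of_multiset (add_mset m M) = m # sorted_list_of_multiset M"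
    using assms by (simp add: insort_is_Cons)
  then show ?thesis by (simp add: of_cnf_def cnf_eval_append)
qed

lemma multiset_max_cases [case_names empty add]:
  fixes M :: "'a::linorder multiset"
  obtains "M = {#}" | m M' where "M = add_mset m M'" "\<forall>x\<in>#M'. x \<le> m"
proof (cases "M = {#}")
  case False
  then have "Max_mset M \<in># M" by simp
  then obtain M' where M': "M = add_mset (Max_mset M) M'" by (metis insert_DiffM)
  then have "\<forall>x\<in>#M'. x \<le> Max_mset M" by (metis Max_ge finite_set_mset insertCI set_mset_add_mset_insert)
  with M' show ?thesis using that(2) by blast
qed (use that in blast)

lemma multiset_min_cases [case_names empty add]:
  fixes M :: "'a::linorder multiset"
  obtains "M = {#}" | m M' where "M = add_mset m M'" "\<forall>x\<in>#M'. m \<le> x"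
proof (cases "M = {#}")
  case False
  then have "Min_mset M \<in># M" by simp
  then obtain M' where M': "M = add_mset (Min_mset M) M'" by (metis insert_DiffM)
  then have "\<forall>x\<in>#M'. Min_mset M \<le> x"
    by (metis Min_le finite_set_mset insertCI set_mset_add_mset_insert)
  with M' show ?thesis using that(2) by blast
qed (use that in blast)

lemma of_cnf_less_oexp_omega: "(\<forall>x\<in>#M. x < e) \<Longrightarrow> of_cnf M < oexp_omega e"
proof (induction "size M" arbitrary: M)
  case 0
  then show ?case by simp
next
  case (Suc n)
  then obtain m M' where M': "M = add_mset m M'" "\<forall>x\<in>#M'. x \<le> m"
    by (cases M rule: multiset_max_cases) auto
  then have "of_cnf M' < oexp_omega e" using Suc by auto
  then show ?case using Suc.prems M' by (simp add: of_cnf_add_max oadd_less_oexp_omega)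
qed

lemma oexp_omega_le_of_cnf:
  assumes "e \<in># M"
  shows "oexp_omega e \<le> of_cnf M"
proof (cases M rule: multiset_max_cases)
  case empty
  with assms show ?thesis by simp
next
  case (add m M')
  then have "e \<le> m" using assms by auto
  then have "oexp_omega e \<le> oexp_omega m" by simp
  also have "\<dots> \<le> of_cnf M" using add by (simp add: of_cnf_add_max le_oadd_left)
  finally show ?thesis .
qed

text \<open>Compare the largest exponents. If they differ, a single power of \<open>N\<close>
  exceeds all of \<open>M\<close>; if they agree, both the multiset order and \<open>oadd\<close>
  allow cancelling them.\<close>

lemma of_cnf_less_mono: "M < N \<Longrightarrow> of_cnf M < of_cnf N"
proof (induction "size M" arbitrary: M N rule: less_induct)
  case less
  obtain n N' where N: "N = add_mset n N'" "\<forall>x\<in>#N'. x \<le> n"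
    using less.prems by (cases N rule: multiset_max_cases) auto
  have N_ge: "oexp_omega n \<le> of_cnf N" using N by (intro oexp_omega_le_of_cnf) simp
  show ?case
  proof (cases M rule: multiset_max_cases)
    case empty
    then show ?thesis using order_less_le_trans[OF oexp_omega_pos N_ge] by simp
  next
    case (add m M')
    have "\<not> n < m"
    proof
      assume "n < m"
      then have "N < M" using N add by (intro ex_gt_imp_less_multiset) (auto intro!: exI[of _ m])
      then show False using less.prems by simp
    qed
    then consider "m < n" | "m = n" by fastforce
    then show ?thesis
    proof cases
      case 1
      then have "of_cnf M < oexp_omega n" using add by (intro of_cnf_less_oexp_omega) auto
      then show ?thesis using N_ge by simp
    next
      case 2
      then have "M' < N'" using less.prems N add by simp
      then have "of_cnf M' < of_cnf N'" using less.hyps add by simp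
      then show ?thesis using 2 N add by (simp add: of_cnf_add_max)
    qed
  qed
qed

lemma of_cnf_less_iff [simp]: "of_cnf M < of_cnf N \<longleftrightarrow> M < N"
  by (metis of_cnf_less_mono linorder_less_linear order_less_asym)

lemma of_cnf_le_iff [simp]: "of_cnf M \<le> of_cnf N \<longleftrightarrow> M \<le> N"
  by (simp add: not_less[symmetric])

lemma of_cnf_eq_iff [simp]: "of_cnf M = of_cnf N \<longleftrightarrow> M = N"
  by (metis of_cnf_less_iff linorder_less_linear order_less_irrefl)

text \<open>Existence of Cantor normal forms: split off the largest power not exceeding
  \<open>a\<close> and recurse on the remainder.\<close>

lemma of_cnf_surj: "\<exists>M. of_cnf M = a"
proof (induction a rule: less_induct)
  case (less a)
  show ?case
  proof (cases "a = ozero")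
    case True
    then show ?thesis using of_cnf_empty by blast
  next
    case False
    \<comment> \<open>Some power exceeds \<open>a\<close>, so the least exponent of such a power
      exists; the leading exponent \<open>c\<close> is found below it.\<close>
    have "a < oexp_omega (osucc a)"
      using le_oexp_omega[of a] oexp_omega_less_mono[of a "osucc a"] less_osucc_iff[of a a]
      by (metis order.refl order_le_less_trans)
    then have s: "a < oexp_omega (LEAST s. a < oexp_omega s)" by (rule LeastI)
    then obtain c n where c: "c < (LEAST s. a < oexp_omega s)"
      and n: "a < omult (oexp_omega c) ((osucc ^^ n) ozero)"
      using False by (elim less_oexp_omegaE) auto
    have "oexp_omega c \<le> a" using not_less_Least[OF c] by simp
    then obtain r where r: "a = oadd (oexp_omega c) r" using oadd_diff_exists by blast
    \<comment> \<open>If \<open>a = omega^c + a\<close>, every finite multiple of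
      \<open>omega^c\<close> would be at most \<open>a\<close>, against the choice of
      \<open>n\<close>.\<close>
    have "r \<noteq> a"
    proof
      assume "r = a"
      have "omult (oexp_omega c) ((osucc ^^ k) ozero) \<le> a" for k
      proof (induction k)
        case (Suc k)
        have "omult (oexp_omega c) ((osucc ^^ (1 + k)) ozero)
            = oadd (oexp_omega c) (omult (oexp_omega c) ((osucc ^^ k) ozero))"
          unfolding omult_finite_add by (simp add: omult_osucc)
        also have "\<dots> \<le> oadd (oexp_omega c) a" using Suc by simp
        also have "\<dots> = a" using r \<open>r = a\<close> by metis
        finally show ?case by simp
      qed simp
      then show False using n by (simp add: not_less[symmetric])
    qed
    then have "r < a" using r le_oadd_right[of r "oexp_omega c"] by simp
    then obtain M where M: "of_cnf M = r" using less.IH by blast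
    have "x \<le> c" if "x \<in># M" for x
    proof (rule leI, rule notI)
      assume "c < x"
      then have "a < oexp_omega x" using n omult_finite_less_oexp_omega[of c x n] by simp
      then show False using oexp_omega_le_of_cnf[OF that] M \<open>r < a\<close> by simp
    qed
    then have "of_cnf (add_mset c M) = a" using M r by (simp add: of_cnf_add_max)
    then show ?thesis by blast
  qed
qed

text \<open>Justifies the \<open>THE\<close> in \<open>cnf\<close>: a decreasing list is determined
  by its multiset, and \<open>of_cnf\<close> is injective.\<close>

lemma mset_cnf_of_cnf [simp]: "mset (cnf (of_cnf M)) = M"
proof -
  let ?bs = "rev (sorted_list_of_multiset M)"
  have "cnf (of_cnf M) = ?bs"
    unfolding cnf_def
  proof (rule the_equality)
    show "sorted_wrt (\<ge>) ?bs \<and> cnf_eval ?bs = of_cnf M"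
      by (simp add: of_cnf_def sorted_wrt_rev)
  next
    fix bs :: "'a ordinal list"
    assume *: "sorted_wrt (\<ge>) bs \<and> cnf_eval bs = of_cnf M"
    then have "sorted (rev bs)" by (simp add: sorted_wrt_rev)
    then have bs: "bs = rev (sorted_list_of_multiset (mset bs))"
      by (metis mset_rev rev_rev_ident sorted_list_of_multiset_mset sorted_sort_id)
    then have "of_cnf (mset bs) = of_cnf M" using * unfolding of_cnf_def by simp
    then show "bs = ?bs" using bs by simp
  qed
  then show ?thesis by simp
qed

lemma of_cnf_mset_cnf [simp]: "of_cnf (mset (cnf a)) = a"
  using of_cnf_surj[of a] by auto

lemma less_iff_mset_cnf: "a < b \<longleftrightarrow> mset (cnf a) < mset (cnf (b :: 'x::infinite ordinal))"
  by (metis of_cnf_less_iff of_cnf_mset_cnf)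

lemma le_iff_mset_cnf: "a \<le> b \<longleftrightarrow> mset (cnf a) \<le> mset (cnf (b :: 'x::infinite ordinal))"
  by (metis less_iff_mset_cnf not_less)

lemma ordinal_eqI: "mset (cnf a) = mset (cnf b) \<Longrightarrow> a = (b :: 'x::infinite ordinal)"
  by (metis of_cnf_mset_cnf)

lemma cnf_eval_rev_sort: "cnf_eval (rev (sort xs)) = of_cnf (mset xs)"
  by (simp add: of_cnf_def sorted_list_of_multiset_mset)

lemma mset_cnf_natural_sum:
  "mset (cnf (natural_sum a b)) = mset (cnf a) + mset (cnf (b :: 'x::infinite ordinal))"
  by (simp add: natural_sum_def cnf_eval_rev_sort)

text \<open>The notation \<open>+\<close> goes to the natural sum, whose commutativity makes
  \<open>\<Sum>\<close> over index sets available; the ordinary sum stays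
  \<open>oadd\<close>.\<close>

instantiation ordinal :: (infinite) comm_monoid_add
begin
definition zero_ordinal :: "'a ordinal" where "zero_ordinal = ozero"
definition plus_ordinal :: "'a ordinal \<Rightarrow> 'a ordinal \<Rightarrow> 'a ordinal" where
  "plus_ordinal = natural_sum"
instance
  by standard (rule ordinal_eqI; simp add: plus_ordinal_def zero_ordinal_def mset_cnf_natural_sum
      mset_cnf_of_cnf[of "{#}", simplified])+
end

lemma mset_cnf_zero [simp]: "mset (cnf (0 :: 'x::infinite ordinal)) = {#}"
  using mset_cnf_of_cnf[of "{#}"] by (simp add: zero_ordinal_def)

lemma mset_cnf_plus [simp]: "mset (cnf (a + b)) = mset (cnf a) + mset (cnf (b :: 'x::infinite ordinal))"
  by (simp add: plus_ordinal_def mset_cnf_natural_sum)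

lemma ozero_eq_zero: "ozero = (0 :: 'x::infinite ordinal)"
  by (simp add: zero_ordinal_def)

text \<open>These are the exponents of a Hessenberg product, so the semiring laws become multiset
  identities.\<close>

definition mset_sums :: "'a::comm_monoid_add multiset \<Rightarrow> 'a multiset \<Rightarrow> 'a multiset" where
  "mset_sums M N = (\<Sum>x\<in>#M. {#x + y. y \<in># N#})"

lemma mset_sums_empty_left [simp]: "mset_sums {#} N = {#}"
  by (simp add: mset_sums_def)

lemma mset_sums_add_left [simp]: "mset_sums (add_mset x M) N = {#x + y. y \<in># N#} + mset_sums M N"
  by (simp add: mset_sums_def)

lemma mset_sums_union_left: "mset_sums (L + M) N = mset_sums L N + mset_sums M N"
  by (simp add: mset_sums_def)

lemma mset_sums_empty_right [simp]: "mset_sums M {#} = {#}"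
  by (induction M) simp_all

lemma mset_sums_add_right: "mset_sums M (add_mset y N) = {#x + y. x \<in># M#} + mset_sums M N"
  by (induction M) (simp_all add: ac_simps)

lemma mset_sums_commute: "mset_sums M N = mset_sums N M"
  by (induction M) (simp_all add: mset_sums_add_right add.commute)

lemma mset_sums_image_left: "mset_sums {#x + y. y \<in># M#} N = {#x + y. y \<in># mset_sums M N#}"
  by (induction M) (auto simp: multiset.map_comp add.assoc intro!: image_mset_cong)

lemma mset_sums_assoc: "mset_sums (mset_sums L M) N = mset_sums L (mset_sums M N)"
  by (induction L) (simp_all add: mset_sums_union_left mset_sums_image_left)

lemma mset_cnf_natural_prod:
  "mset (cnf (natural_prod a b)) = mset_sums (mset (cnf a)) (mset (cnf (b :: 'x::infinite ordinal)))"
proof -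
  have "mset (concat (map (\<lambda>x. map (natural_sum x) ys) xs)) = mset_sums (mset xs) (mset ys)"
    for xs ys :: "'x ordinal list"
    by (induction xs) (simp_all add: plus_ordinal_def)
  then show ?thesis by (simp add: natural_prod_def cnf_eval_rev_sort)
qed

instantiation ordinal :: (infinite) comm_semiring_1
begin
definition one_ordinal :: "'a ordinal" where "one_ordinal = oone"
definition times_ordinal :: "'a ordinal \<Rightarrow> 'a ordinal \<Rightarrow> 'a ordinal" where
  "times_ordinal = natural_prod"
instance
proof
  fix a b c :: "'a ordinal"
  have one: "mset (cnf (1 :: 'a ordinal)) = {#0#}"
    using mset_cnf_of_cnf[of "{#ozero#}"]
    by (simp add: of_cnf_single one_ordinal_def zero_ordinal_def)
  note [simp] = times_ordinal_def mset_cnf_natural_prod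
  show "a * b * c = a * (b * c)" by (rule ordinal_eqI) (simp add: mset_sums_assoc)
  show "a * b = b * a" by (rule ordinal_eqI) (simp add: mset_sums_commute)
  show "1 * a = a" by (rule ordinal_eqI) (simp add: one)
  show "(a + b) * c = a * c + b * c" by (rule ordinal_eqI) (simp add: mset_sums_union_left)
  show "0 * a = 0" by (rule ordinal_eqI) simp
  show "a * 0 = 0" by (rule ordinal_eqI) simp
  show "(0 :: 'a ordinal) \<noteq> 1" using one mset_cnf_zero by (metis add_mset_not_empty)
qed
end

lemma mset_cnf_oexp_omega [simp]: "mset (cnf (oexp_omega e)) = {#e :: 'x::infinite ordinal#}"
  using mset_cnf_of_cnf[of "{#e#}"] by (simp add: of_cnf_single)

lemma oexp_omega_add: "oexp_omega (a + b) = oexp_omega a * oexp_omega (b :: 'x::infinite ordinal)"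
  by (rule ordinal_eqI) (simp add: times_ordinal_def mset_cnf_natural_prod)

lemma oexp_omega_zero [simp]: "oexp_omega 0 = (1 :: 'x::infinite ordinal)"
  by (simp add: zero_ordinal_def one_ordinal_def)

lemma oexp_omega_sum:
  "oexp_omega (\<Sum>k\<in>I. f k) = (\<Prod>k\<in>I. oexp_omega (f k :: 'x::infinite ordinal))"
  by (induction I rule: infinite_finite_induct) (simp_all add: oexp_omega_add)

lemma of_cnf_union: "of_cnf (M + N) = of_cnf M + of_cnf N"
  by (rule ordinal_eqI) simp

lemma of_cnf_add_mset: "of_cnf (add_mset e M) = oexp_omega e + of_cnf M"
  by (rule ordinal_eqI) simp

lemma ordinal_not_less_zero [simp]: "\<not> (a :: 'x::infinite ordinal) < 0"
  by (simp add: zero_ordinal_def)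

lemma ordinal_zero_less_iff: "0 < (a :: 'x::infinite ordinal) \<longleftrightarrow> a \<noteq> 0"
  by (simp add: zero_ordinal_def ozero_less_iff)

lemma ordinal_less_one_iff [simp]: "(a :: 'x::infinite ordinal) < 1 \<longleftrightarrow> a = 0"
  by (simp add: zero_ordinal_def one_ordinal_def)

section \<open>Order properties of the natural operations\<close>

instance ordinal :: (infinite) ordered_comm_monoid_add
  by standard (simp add: le_iff_mset_cnf)

lemma ordinal_add_less_mono: "a < b \<Longrightarrow> a + c < b + (c :: 'x::infinite ordinal)"
  by (simp add: less_iff_mset_cnf)

lemma ordinal_add_less_mono': "a < b \<Longrightarrow> c + a < c + (b :: 'x::infinite ordinal)"
  by (simp add: less_iff_mset_cnf)

lemma of_cnf_image_mset: "finite S \<Longrightarrow> of_cnf (image_mset g (mset_set S)) = (\<Sum>p\<in>S. oexp_omega (g p))"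
  by (induction S rule: finite_induct) (simp_all add: of_cnf_add_mset ozero_eq_zero)

lemma sum_fun_upd_less:
  assumes "finite I" "k \<in> I" "d < (b k :: 'x::infinite ordinal)"
  shows "(\<Sum>i\<in>I. (b(k := d)) i) < (\<Sum>i\<in>I. b i)"
proof -
  have "(\<Sum>i\<in>I - {k}. (b(k := d)) i) = (\<Sum>i\<in>I - {k}. b i)" by (rule sum.cong) auto
  then show ?thesis
    using assms by (simp add: sum.remove[of I k] ordinal_add_less_mono)
qed

lemma less_oexp_omega_iff_cnf:
  "a < oexp_omega e \<longleftrightarrow> (\<forall>x\<in>#mset (cnf a). x < (e :: 'x::infinite ordinal))"
  by (simp add: less_iff_mset_cnf)

lemma add_less_oexp_omega:
  "a < oexp_omega e \<Longrightarrow> b < oexp_omega e \<Longrightarrow> a + b < oexp_omega (e :: 'x::infinite ordinal)"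
  by (auto simp: less_oexp_omega_iff_cnf simp del: set_mset_mset)

lemma sum_less_oexp_omega:
  "(\<And>k. k \<in> I \<Longrightarrow> f k < oexp_omega e) \<Longrightarrow> (\<Sum>k\<in>I. f k) < oexp_omega (e :: 'x::infinite ordinal)"
  by (induction I rule: infinite_finite_induct)
    (auto simp: add_less_oexp_omega zero_ordinal_def)

text \<open>All exponents of \<open>b\<close> are below those of \<open>M\<close>, so the two normal
  forms concatenate in sorted order and nothing is absorbed.\<close>

lemma oadd_eq_add:
  assumes "\<forall>x\<in>#M. e \<le> x" "b < oexp_omega e"
  shows "oadd (of_cnf M) b = of_cnf M + b"
proof -
  have "\<forall>x\<in>#N. x < e \<Longrightarrow> oadd (of_cnf M) (of_cnf N) = of_cnf M + of_cnf N" for N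
    using assms(1)
  proof (induction "size M" arbitrary: M)
    case 0
    then have "M = {#}" by simp
    then show ?case by (simp add: ozero_oadd) (simp add: ozero_eq_zero)
  next
    case (Suc n)
    then obtain m M' where M': "M = add_mset m M'" "\<forall>x\<in>#M'. x \<le> m"
      by (cases M rule: multiset_max_cases) auto
    have IH: "oadd (of_cnf M') (of_cnf N) = of_cnf M' + of_cnf N" using Suc M' by simp
    have "e \<le> m" using Suc M' by simp
    have "oadd (of_cnf M) (of_cnf N) = oadd (oexp_omega m) (of_cnf (M' + N))"
      using M' IH by (simp add: of_cnf_add_max oadd_assoc of_cnf_union)
    also have "\<dots> = of_cnf (add_mset m (M' + N))"
      using M' Suc \<open>e \<le> m\<close> by (subst of_cnf_add_max) fastforce+
    also have "\<dots> = of_cnf M + of_cnf N" using M' by (simp add: of_cnf_union[symmetric])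
    finally show ?case .
  qed
  then show ?thesis
    using assms(2) less_oexp_omega_iff_cnf[of b e] of_cnf_mset_cnf[of b] by metis
qed

text \<open>At the largest exponent \<open>m\<close> where \<open>s\<close> and \<open>a + b\<close>
  differ, \<open>s\<close> has fewer copies. Giving up one copy of \<open>m\<close> in a summand
  that contains it makes room for all smaller exponents of \<open>s\<close>.\<close>

lemma less_add_ordinalE:
  assumes "s < a + (b :: 'x::infinite ordinal)"
  obtains a' where "a' < a" "s \<le> a' + b" | b' where "b' < b" "s \<le> a + b'"
proof -
  have half: "\<exists>A'. A' < A \<and> S \<subseteq># A' + B"
    if "m \<in># A" "\<And>x. m < x \<Longrightarrow> count S x = count (A + B) x" "count S m < count (A + B) m"
    for A B S :: "'x ordinal multiset" and m
  proof -
    \<comment> \<open>Exponents above \<open>m\<close> stay, one copy of \<open>m\<close> is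
      dropped, and everything below \<open>m\<close> is replaced by the exponents of
      \<open>S\<close> there.\<close>
    define A' where "A' = filter_mset (\<lambda>x. m \<le> x) A - {#m#} + filter_mset (\<lambda>x. x < m) S"
    have cnt: "count A' x = (if m < x then count A x else if x = m then count A m - 1 else count S x)" for x
      by (auto simp: A'_def)
    have "count A m > 0" using that(1) by simp
    then have "A' < A"
      unfolding less_multiset\<^sub>H\<^sub>O
    proof (intro conjI allI impI notI)
      assume "A' = A"
      then have "count A m = count A m - 1" using cnt[of m] by simp
      then show False using \<open>count A m > 0\<close> by linarith
    next
      fix y assume "count A y < count A' y"
      then have "y < m" using cnt[of y] by (auto split: if_splits)
      moreover have "count A' m < count A m" using cnt[of m] \<open>count A m > 0\<close> by simp
      ultimately show "\<exists>x>y. count A' x < count A x" by blast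
    qed
    moreover have "count S x \<le> count (A' + B) x" for x
      using cnt[of x] that(2)[of x] that(3) by (auto simp: not_less)
    ultimately show ?thesis using mset_subset_eqI by blast
  qed
  let ?S = "mset (cnf s)" and ?A = "mset (cnf a)" and ?B = "mset (cnf b)"
  have less: "?S < ?A + ?B" using assms by (simp add: less_iff_mset_cnf)
  define D where "D = {x. count ?S x \<noteq> count (?A + ?B) x}"
  have "finite {x. count M x \<noteq> count N x}" for M N :: "'x ordinal multiset"
    by (rule finite_subset[of _ "set_mset (M + N)"]) (auto simp: not_in_iff)
  then have fin: "finite D" unfolding D_def .
  have "?S \<noteq> ?A + ?B" using less by auto
  then have "D \<noteq> {}" by (auto simp: D_def multiset_eq_iff)
  define m where "m = Max D"
  have m: "m \<in> D" using fin \<open>D \<noteq> {}\<close> by (simp add: m_def)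
  have above: "count ?S x = count (?A + ?B) x" if "m < x" for x
    using that fin Max_ge[OF fin, of x] by (fastforce simp: D_def m_def)
  have cm: "count ?S m < count (?A + ?B) m"
  proof (rule ccontr)
    assume "\<not> ?thesis"
    then have "count (?A + ?B) m < count ?S m" using m by (simp add: D_def)
    then obtain x where "m < x" "count ?S x < count (?A + ?B) x"
      using less unfolding less_multiset\<^sub>H\<^sub>O by blast
    then show False using above by simp
  qed
  have le: "s \<le> of_cnf C + c" if "?S \<subseteq># C + mset (cnf c)" for C c
    using subset_eq_imp_le_multiset[OF that] by (simp add: le_iff_mset_cnf)
  from cm consider "m \<in># ?A" | "m \<in># ?B"
    by (metis add_is_0 count_union gr_implies_not0 not_in_iff)
  then show thesis
  proof cases
    case 1
    then obtain A' where "A' < ?A" "?S \<subseteq># A' + ?B" using half above cm by blast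
    then show thesis using that(1)[of "of_cnf A'"] le by (simp add: less_iff_mset_cnf)
  next
    case 2
    then obtain B' where "B' < ?B" "?S \<subseteq># B' + ?A" 
      using half[of m ?B ?S ?A] above cm by (auto simp: add.commute)
    then show thesis using that(2)[of "of_cnf B'"] le by (simp add: less_iff_mset_cnf add.commute)
  qed
qed

lemma less_sum_ordinalE:
  assumes "finite I" "s < (\<Sum>k\<in>I. c k :: 'x::infinite ordinal)"
  obtains i d where "i \<in> I" "d < c i" "s \<le> (\<Sum>k\<in>I. (c(i := d)) k)"
proof -
  have "\<exists>i\<in>I. \<exists>d<c i. s \<le> (\<Sum>k\<in>I. (c(i := d)) k)"
    using assms
  proof (induction I arbitrary: s rule: finite_induct)
    case (insert x I)
    have same: "(\<Sum>k\<in>I. (c(x := d)) k) = (\<Sum>k\<in>I. c k)" for d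
      using insert by (intro sum.cong) auto
    have "s < c x + (\<Sum>k\<in>I. c k)" using insert by simp
    then show ?case
    proof (cases rule: less_add_ordinalE)
      case (1 a')
      then show ?thesis using insert same[of a'] by (intro bexI[of _ x] exI[of _ a']) auto
    next
      case (2 b')
      obtain i d where i: "i \<in> I" "d < c i" "b' \<le> (\<Sum>k\<in>I. (c(i := d)) k)"
        using insert.IH[OF 2(1)] by blast
      then have "s \<le> c x + (\<Sum>k\<in>I. (c(i := d)) k)" using 2(2) add_left_mono order_trans by blast
      then show ?thesis using i insert by (intro bexI[of _ i] exI[of _ d]) auto
    qed
  qed simp
  then show thesis using that by blast
qed

lemma replicate_mset_mono: "s \<le> (t :: 'a::linorder) \<Longrightarrow> replicate_mset n s \<le> replicate_mset n t"
  by (induction n) (auto intro: add_mset_le_le_le)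

text \<open>Raise every exponent of \<open>d\<close> to the largest one. For \<open>d = 0\<close>
  there is none, and \<open>e \<noteq> 0\<close> permits exponent 0 with no copies.\<close>

lemma less_oexp_omega_replicateE:
  assumes "d < oexp_omega e" "(e :: 'x::infinite ordinal) \<noteq> 0"
  obtains s n where "s < e" "d \<le> of_cnf (replicate_mset n s)"
proof -
  have rep: "M \<le> replicate_mset (size M) s" if "\<forall>x\<in>#M. x \<le> s" for M and s :: "'x ordinal"
    using that by (induction M) (auto intro: add_mset_le_le_le)
  show thesis
  proof (cases "cnf d = []")
    case True
    then have "d = 0" by (metis mset.simps(1) mset_cnf_zero ordinal_eqI)
    then show thesis using that[of 0 0] assms(2) ordinal_zero_less_iff[of e]
      by (simp add: ozero_eq_zero)
  next
    case False
    let ?s = "Max (set (cnf d))"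
    have "?s \<in> set (cnf d)" using False by simp
    then have "?s < e" using assms(1) by (simp add: less_oexp_omega_iff_cnf)
    moreover have "d \<le> of_cnf (replicate_mset (size (mset (cnf d))) ?s)"
      unfolding le_iff_mset_cnf[of d] mset_cnf_of_cnf by (rule rep) simp
    ultimately show thesis using that by blast
  qed
qed

section \<open>Ranks of forests of sequences\<close>

text \<open>Bounds for the rank of the forest of sequences in \<open>A\<close> whose earlier entries
  are \<open>Q\<close>-related to all later ones; \<open>{y \<in> A. Q x y}\<close> holds the moves
  left after \<open>x\<close>. Two predicates in place of a function let each bound be proved by
  itself, without well-foundedness or suprema.\<close>

inductive rank_le :: "('b \<Rightarrow> 'b \<Rightarrow> bool) \<Rightarrow> 'b set \<Rightarrow> 'x ordinal \<Rightarrow> bool" for Q where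
  rank_leI: "(\<And>x. x \<in> A \<Longrightarrow> \<exists>b<a. rank_le Q {y \<in> A. Q x y} b) \<Longrightarrow> rank_le Q A a"

inductive rank_ge :: "('b \<Rightarrow> 'b \<Rightarrow> bool) \<Rightarrow> 'b set \<Rightarrow> 'x ordinal \<Rightarrow> bool" for Q where
  rank_geI: "(\<And>b. b < a \<Longrightarrow> \<exists>x\<in>A. rank_ge Q {y \<in> A. Q x y} b) \<Longrightarrow> rank_ge Q A a"

definition has_rank :: "('b \<Rightarrow> 'b \<Rightarrow> bool) \<Rightarrow> 'b set \<Rightarrow> 'x ordinal \<Rightarrow> bool" where
  "has_rank Q A a \<longleftrightarrow> rank_le Q A a \<and> rank_ge Q A a"

lemma rank_leD: "rank_le Q A a \<Longrightarrow> x \<in> A \<Longrightarrow> \<exists>b<a. rank_le Q {y \<in> A. Q x y} b"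
  by (auto elim: rank_le.cases)

lemma rank_geD: "rank_ge Q A a \<Longrightarrow> b < a \<Longrightarrow> \<exists>x\<in>A. rank_ge Q {y \<in> A. Q x y} b"
  by (auto elim: rank_ge.cases)

text \<open>The relation may shrink as well: passing from \<open>nle\<close> to incomparability is
  how the width gets bounded by the maximal order type.\<close>

lemma rank_le_mono:
  assumes "rank_le Q A a" "A' \<subseteq> A" "a \<le> a'" "\<And>x y. x \<in> A' \<Longrightarrow> y \<in> A' \<Longrightarrow> Q' x y \<Longrightarrow> Q x y"
  shows "rank_le Q' A' a'"
  using assms
proof (induction a arbitrary: A A' a' rule: less_induct)
  case (less a)
  show ?case
  proof (rule rank_leI)
    fix x assume x: "x \<in> A'"
    then obtain b where b: "b < a" "rank_le Q {y \<in> A. Q x y} b"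
      using rank_leD[OF less.prems(1)] less.prems(2) by blast
    have "rank_le Q' {y \<in> A'. Q' x y} b"
      using less.prems x by (intro less.IH[OF b]) auto
    then show "\<exists>b<a'. rank_le Q' {y \<in> A'. Q' x y} b"
      using b(1) less.prems(3) by (meson order_less_le_trans)
  qed
qed

lemma rank_ge_mono:
  assumes "rank_ge Q A a" "A \<subseteq> A'" "a' \<le> a"
  shows "rank_ge Q A' a'"
  using assms
proof (induction a' arbitrary: A A' a rule: less_induct)
  case (less a')
  show ?case
  proof (rule rank_geI)
    fix b assume b: "b < a'"
    then have "b < a" using less.prems by simp
    then obtain x where x: "x \<in> A" "rank_ge Q {y \<in> A. Q x y} b"
      using rank_geD[OF less.prems(1)] by blast
    have "rank_ge Q {y \<in> A'. Q x y} b"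
      using less.prems by (intro less.IH[OF b x(2)]) auto
    then show "\<exists>x\<in>A'. rank_ge Q {y \<in> A'. Q x y} b"
      using x less.prems by blast
  qed
qed

lemma rank_ge_le_rank_le:
  assumes "rank_le Q A a" "rank_ge Q A b"
  shows "b \<le> a"
  using assms
proof (induction a arbitrary: A b rule: less_induct)
  case (less a)
  show ?case
  proof (rule leI, rule notI)
    assume "a < b"
    then obtain x where x: "x \<in> A" "rank_ge Q {y \<in> A. Q x y} a"
      using rank_geD[OF less.prems(2)] by blast
    obtain c where c: "c < a" "rank_le Q {y \<in> A. Q x y} c"
      using rank_leD[OF less.prems(1) x(1)] by blast
    then have "a \<le> c" using less.IH x(2) by blast
    then show False using c(1) by simp
  qed
qed

lemma has_rank_unique: "has_rank Q A a \<Longrightarrow> rank_le Q A b \<Longrightarrow> rank_ge Q A b \<Longrightarrow> a = b"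
  unfolding has_rank_def by (meson order.antisym rank_ge_le_rank_le)

text \<open>A move \<open>x\<close> whose residual has lower bounds \<open>osucc b\<close> for all
  \<open>b < a\<close> witnesses \<open>osucc a\<close>; without such a move, induction gives every
  residual an upper bound below \<open>a\<close>. This makes the least upper bound attained.\<close>

lemma rank_le_or_rank_ge: "rank_le Q A a \<or> rank_ge Q A (osucc (a :: 'x::infinite ordinal))"
proof (induction a arbitrary: A rule: less_induct)
  case (less a)
  show ?case
  proof (cases "\<exists>x\<in>A. \<forall>b<a. rank_ge Q {y \<in> A. Q x y} (osucc b)")
    case True
    then obtain x where x: "x \<in> A" "\<And>b. b < a \<Longrightarrow> rank_ge Q {y \<in> A. Q x y} (osucc b)" by blast
    have "rank_ge Q {y \<in> A. Q x y} a"
      using rank_geD[OF x(2)] by (intro rank_geI) (auto simp: less_osucc_iff)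
    then have "rank_ge Q A (osucc a)"
      using x(1) by (intro rank_geI) (auto simp: less_osucc_iff intro: rank_ge_mono)
    then show ?thesis ..
  next
    case False
    then have "rank_le Q A a" using less.IH by (intro rank_leI) blast
    then show ?thesis ..
  qed
qed

lemma has_rank_exists:
  assumes "rank_le Q A (a :: 'x::infinite ordinal)"
  obtains b where "b \<le> a" "has_rank Q A b"
proof -
  let ?b = "LEAST b :: 'x ordinal. rank_le Q A b"
  have le: "rank_le Q A ?b" using assms by (rule LeastI[of "rank_le Q A"])
  have "rank_ge Q A ?b"
  proof (rule rank_geI)
    fix c assume "c < ?b"
    then have "rank_ge Q A (osucc c)" using rank_le_or_rank_ge not_less_Least by blast
    then show "\<exists>x\<in>A. rank_ge Q {y \<in> A. Q x y} c"
      using rank_geD less_osucc_iff[of c c] by blast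
  qed
  then show thesis using that[of ?b] le assms by (simp add: has_rank_def Least_le)
qed

lemma has_rank_subset:
  assumes "has_rank Q A (a :: 'x::infinite ordinal)" "A' \<subseteq> A"
  obtains b where "b \<le> a" "has_rank Q A' b"
  using assms has_rank_exists[of Q A' a] rank_le_mono[of Q A a A' a Q] by (auto simp: has_rank_def)

lemma rank_le_empty [simp]: "rank_le Q {} a"
  by (rule rank_leI) simp

lemma rank_ge_zero [simp]: "rank_ge Q A (0 :: 'x::infinite ordinal)"
  by (rule rank_geI) simp

lemma rank_le_zeroD: "rank_le Q A (0 :: 'x::infinite ordinal) \<Longrightarrow> A = {}"
  using rank_leD by fastforce

text \<open>A move in \<open>X\<close> lowers the first summand and a move in \<open>Y\<close> the
  second; the natural sum is strictly monotone in both.\<close>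

lemma rank_le_Un:
  assumes "rank_le Q X a" "rank_le Q Y (b :: 'x::infinite ordinal)"
  shows "rank_le Q (X \<union> Y) (a + b)"
  using assms
proof (induction "a + b" arbitrary: X Y a b rule: less_induct)
  case less
  show ?case
  proof (rule rank_leI)
    fix z assume z: "z \<in> X \<union> Y"
    have split: "{y \<in> X \<union> Y. Q z y} = {y \<in> X. Q z y} \<union> {y \<in> Y. Q z y}" by auto
    have res: "rank_le Q {y \<in> X. Q z y} a" "rank_le Q {y \<in> Y. Q z y} b"
      using less.prems by (auto intro: rank_le_mono)
    show "\<exists>c<a + b. rank_le Q {y \<in> X \<union> Y. Q z y} c"
    proof (cases "z \<in> X")
      case True
      then obtain c where "c < a" "rank_le Q {y \<in> X. Q z y} c"
        using rank_leD[OF less.prems(1)] by blast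
      moreover from this have "rank_le Q ({y \<in> X. Q z y} \<union> {y \<in> Y. Q z y}) (c + b)"
        using res by (intro less.hyps) (auto simp: ordinal_add_less_mono)
      ultimately show ?thesis unfolding split using ordinal_add_less_mono[of c a b] by blast
    next
      case False
      then obtain c where "c < b" "rank_le Q {y \<in> Y. Q z y} c"
        using rank_leD[OF less.prems(2)] z by blast
      moreover from this have "rank_le Q ({y \<in> X. Q z y} \<union> {y \<in> Y. Q z y}) (a + c)"
        using res by (intro less.hyps) (auto simp: ordinal_add_less_mono')
      ultimately show ?thesis unfolding split using ordinal_add_less_mono'[of c b a] by blast
    qed
  qed
qed

lemma rank_le_UN:
  assumes "finite S" "\<And>p. p \<in> S \<Longrightarrow> rank_le Q (X p) (f p :: 'x::infinite ordinal)"
  shows "rank_le Q (\<Union>p\<in>S. X p) (\<Sum>p\<in>S. f p)"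
  using assms by (induction S rule: finite_induct) (simp_all add: rank_le_Un)

text \<open>Play in \<^term>\<open>Y\<close> first; the finitely many moves made there leave enough room in \<^term>\<open>X\<close>.\<close>
lemma rank_ge_Un_avoiding:
  assumes "rank_ge Q Y (b :: 'x::infinite ordinal)"
    and avoid: "\<And>F. finite F \<Longrightarrow> F \<subseteq> Y \<Longrightarrow> rank_ge Q {x \<in> X. \<forall>y\<in>F. Q y x} a"
  shows "rank_ge Q (X \<union> Y) (oadd a b)"
proof -
  \<comment> \<open>Generalised to the part \<open>Y'\<close> of \<open>Y\<close> still playable and
    the set \<open>F\<close> of moves already made, which restrict \<open>X\<close>.\<close>
  have "rank_ge Q ({x \<in> X. \<forall>y\<in>F. Q y x} \<union> Y') (oadd a b)"
    if "rank_ge Q Y' b" "Y' \<subseteq> Y" "finite F" "F \<subseteq> Y" for Y' F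
    using that
  proof (induction b arbitrary: Y' F rule: less_induct)
    case (less b)
    let ?X = "{x \<in> X. \<forall>y\<in>F. Q y x}"
    show ?case
    proof (rule rank_geI)
      fix d assume d: "d < oadd a b"
      show "\<exists>x\<in>?X \<union> Y'. rank_ge Q {y \<in> ?X \<union> Y'. Q x y} d"
      proof (cases "\<exists>c<b. d \<le> oadd a c")
        case True
        then obtain c where c: "c < b" "d \<le> oadd a c" by blast
        then obtain y where y: "y \<in> Y'" "rank_ge Q {z \<in> Y'. Q y z} c"
          using rank_geD less.prems(1) by blast
        have "rank_ge Q ({x \<in> X. \<forall>y\<in>insert y F. Q y x} \<union> {z \<in> Y'. Q y z}) (oadd a c)"
          using less.prems y c by (intro less.IH) auto
        then have "rank_ge Q {z \<in> ?X \<union> Y'. Q y z} d"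
          by (rule rank_ge_mono) (use c in auto)
        then show ?thesis using y by blast
      next
        case False
        then have "d < a" using d less_oadd_iff[of d a b] by blast
        then obtain x where x: "x \<in> ?X" "rank_ge Q {y \<in> ?X. Q x y} d"
          using rank_geD[OF avoid[OF less.prems(3,4)]] by blast
        have "rank_ge Q {y \<in> ?X \<union> Y'. Q x y} d"
          by (rule rank_ge_mono[OF x(2)]) auto
        then show ?thesis using x(1) by blast
      qed
    qed
  qed
  from this[OF assms(1), of "{}"] show ?thesis by simp
qed

section \<open>Partition into pieces of indecomposable type\<close>

abbreviation (input) nle :: "('b \<Rightarrow> 'b \<Rightarrow> bool) \<Rightarrow> 'b \<Rightarrow> 'b \<Rightarrow> bool" where
  "nle le \<equiv> \<lambda>x y. \<not> le x y"

text \<open>Descends through residuals until the rank is exactly \<open>g\<close>. The elements not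
  above \<open>x\<close> form a downward closed set, which separates it from its complement.\<close>

lemma has_rank_downset:
  assumes "has_rank (nle le) A (a :: 'x::infinite ordinal)" "g \<le> a" "transp_on A le"
  obtains D where "D \<subseteq> A" "has_rank (nle le) D g" "\<And>u d. u \<in> A - D \<Longrightarrow> d \<in> D \<Longrightarrow> \<not> le u d"
proof -
  have "\<exists>D\<subseteq>A. has_rank (nle le) D g \<and> (\<forall>u\<in>A - D. \<forall>d\<in>D. \<not> le u d)"
    using assms
  proof (induction a arbitrary: A rule: less_induct)
    case (less a)
    show ?case
    proof (cases "g = a")
      case True
      then show ?thesis using less.prems by blast
    next
      case False
      then have "g < a" using less.prems by simp
      then obtain x where x: "x \<in> A" "rank_ge (nle le) {y \<in> A. \<not> le x y} g"
        using rank_geD[of "nle le" A a g] less.prems(1) unfolding has_rank_def by auto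
      obtain c where c: "c < a" "rank_le (nle le) {y \<in> A. \<not> le x y} c"
        using rank_leD[of "nle le" A a x] less.prems(1) x(1) unfolding has_rank_def by auto
      obtain c' where "c' \<le> c" "has_rank (nle le) {y \<in> A. \<not> le x y} c'"
        using c(2) by (rule has_rank_exists)
      then have c': "c' < a" "has_rank (nle le) {y \<in> A. \<not> le x y} c'" using c(1) by auto
      moreover have "g \<le> c'" using x(2) c'(2) rank_ge_le_rank_le unfolding has_rank_def by blast
      moreover have "transp_on {y \<in> A. \<not> le x y} le"
        using less.prems(3) by (rule transp_on_subset) auto
      ultimately have "\<exists>D\<subseteq>{y \<in> A. \<not> le x y}. has_rank (nle le) D g \<and>
          (\<forall>u\<in>{y \<in> A. \<not> le x y} - D. \<forall>d\<in>D. \<not> le u d)"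
        by (rule less.IH)
      then obtain D where D: "D \<subseteq> {y \<in> A. \<not> le x y}" "has_rank (nle le) D g"
        "\<forall>u\<in>{y \<in> A. \<not> le x y} - D. \<forall>d\<in>D. \<not> le u d"
        by blast
      have "\<not> le u d" if "u \<in> A - D" "d \<in> D" for u d
      proof (cases "le x u")
        case True
        have "\<not> le x d" "d \<in> A" using that D(1) by auto
        then show ?thesis
          using True that x(1) less.prems(3) by (meson DiffD1 transp_onD)
      next
        case False
        then show ?thesis using that D by blast
      qed
      then show ?thesis using D by blast
    qed
  qed
  then show thesis using that by blast
qed

text \<open>Induction on the number of exponents: a downward closed \<open>D\<close> takes all but
  the smallest exponent \<open>m\<close>, and the rest of \<open>A\<close> becomes the last
  piece.\<close>

lemma indecomposable_partition_mset:
  fixes M :: "'x::infinite ordinal multiset"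
  assumes "has_rank (nle le) A (of_cnf M)" "transp_on A le"
  shows "\<exists>e B. M = image_mset e (mset_set {..<size M}) \<and> (\<Union>p<size M. B p) = A \<and>
    (\<forall>p<size M. has_rank (nle le) (B p) (oexp_omega (e p))) \<and>
    (\<forall>p q. p < q \<longrightarrow> q < size M \<longrightarrow> (\<forall>u\<in>B q. \<forall>d\<in>B p. \<not> le u d)) \<and>
    (\<forall>p q. p \<le> q \<longrightarrow> q < size M \<longrightarrow> e q \<le> e p)"
  using assms
proof (induction "size M" arbitrary: M A)
  case 0
  then have "A = {}" "M = {#}"
    using rank_le_zeroD by (auto simp: has_rank_def ozero_eq_zero)
  then show ?case by simp
next
  case (Suc n)
  then obtain m M' where M: "M = add_mset m M'" and min: "\<forall>x\<in>#M'. m \<le> x"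
    by (cases M rule: multiset_min_cases) auto
  define g where "g = of_cnf M'"
  have val: "of_cnf M = oadd g (oexp_omega m)" using min M by (simp add: of_cnf_add_min g_def)
  then have g: "g \<le> of_cnf M" by (simp add: le_oadd_left)
  obtain D where D: "D \<subseteq> A" "has_rank (nle le) D g"
    and DU: "\<And>u d. u \<in> A - D \<Longrightarrow> d \<in> D \<Longrightarrow> \<not> le u d"
    by (rule has_rank_downset[OF Suc.prems(1) g Suc.prems(2)]) blast
  obtain v :: "'x ordinal" where v: "has_rank (nle le) (A - D) v"
    by (rule has_rank_subset[OF Suc.prems(1), of "A - D"]) auto
  have A_eq: "D \<union> (A - D) = A" using D(1) by auto
  \<comment> \<open>Playing in \<open>A - D\<close> first costs nothing in \<open>D\<close>, since
    no element of \<open>A - D\<close> lies below one of \<open>D\<close>.\<close>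
  have "rank_ge (nle le) (D \<union> (A - D)) (oadd g v)"
  proof (rule rank_ge_Un_avoiding)
    fix F assume "F \<subseteq> A - D"
    then have "{x \<in> D. \<forall>y\<in>F. \<not> le y x} = D" using DU by auto
    then show "rank_ge (nle le) {x \<in> D. \<forall>y\<in>F. \<not> le y x} g" using D(2) by (simp add: has_rank_def)
  qed (use v in \<open>simp add: has_rank_def\<close>)
  then have "oadd g v \<le> oadd g (oexp_omega m)"
    using rank_ge_le_rank_le Suc.prems(1) unfolding A_eq has_rank_def val by blast
  then have "v \<le> oexp_omega m" by simp
  \<comment> \<open>For smaller \<open>v\<close>, ordinary and natural sum of \<open>g\<close> and
    \<open>v\<close> agree, and subadditivity would bound the rank of \<open>A\<close> too
    low.\<close>
  moreover have "\<not> v < oexp_omega m"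
  proof
    assume less: "v < oexp_omega m"
    then have "oadd g v = g + v" unfolding g_def using min by (intro oadd_eq_add) auto
    moreover have "rank_le (nle le) (D \<union> (A - D)) (g + v)"
      using D(2) v by (intro rank_le_Un) (auto simp: has_rank_def)
    ultimately have "oadd g (oexp_omega m) \<le> oadd g v"
      using rank_ge_le_rank_le Suc.prems(1) unfolding A_eq has_rank_def val by metis
    then show False using less by simp
  qed
  ultimately have U: "has_rank (nle le) (A - D) (oexp_omega m)" using v by simp
  have n: "n = size M'" "size M = Suc n" using Suc.hyps(2) M by auto
  have "transp_on D le" using Suc.prems(2) D(1) transp_on_subset by blast
  then obtain e B where IH: "M' = image_mset e (mset_set {..<n})" "(\<Union>p<n. B p) = D"
    "\<And>p. p < n \<Longrightarrow> has_rank (nle le) (B p) (oexp_omega (e p))"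
    "\<And>p q u d. p < q \<Longrightarrow> q < n \<Longrightarrow> u \<in> B q \<Longrightarrow> d \<in> B p \<Longrightarrow> \<not> le u d"
    "\<And>p q. p \<le> q \<Longrightarrow> q < n \<Longrightarrow> e q \<le> e p"
    using Suc.hyps(1)[OF n(1), of D] D(2) n(1) unfolding g_def by blast
  define e' where "e' = e(n := m)"
  define B' where "B' = B(n := A - D)"
  have "M = image_mset e' (mset_set {..<Suc n})"
  proof -
    have "image_mset e' (mset_set {..<n}) = image_mset e (mset_set {..<n})"
      by (rule image_mset_cong) (auto simp: e'_def)
    then show ?thesis using M IH(1) by (simp add: lessThan_Suc e'_def)
  qed
  moreover have "(\<Union>p<Suc n. B' p) = A"
  proof -
    have "(\<Union>p<n. B' p) = (\<Union>p<n. B p)" by (auto simp: B'_def)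
    then show ?thesis using IH(2) D(1) by (auto simp: lessThan_Suc B'_def)
  qed
  moreover have "\<forall>p<Suc n. has_rank (nle le) (B' p) (oexp_omega (e' p))"
    using IH(3) U by (auto simp: e'_def B'_def less_Suc_eq)
  moreover have "\<not> le u d" if "p < q" "q < Suc n" "u \<in> B' q" "d \<in> B' p" for p q u d
  proof (cases "q = n")
    case True
    have "d \<in> B p" "p \<in> {..<n}" using that True by (auto simp: B'_def)
    then have "d \<in> D" using IH(2) by blast
    then show ?thesis using that(3) True DU by (simp add: B'_def)
  next
    case False
    then show ?thesis using that IH(4) by (auto simp: B'_def)
  qed
  moreover have "e' q \<le> e' p" if pq: "p \<le> q" "q < Suc n" for p q
  proof -
    have "m \<le> e p" if "p < n" using min IH(1) that by auto
    then show ?thesis using pq IH(5) by (auto simp: e'_def less_Suc_eq)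
  qed
  ultimately show ?case unfolding n(2) by blast
qed

definition cnf_partition ::
    "('b \<Rightarrow> 'b \<Rightarrow> bool) \<Rightarrow> 'b set \<Rightarrow> 'x::infinite ordinal \<Rightarrow> nat \<Rightarrow> (nat \<Rightarrow> 'x ordinal) \<Rightarrow> (nat \<Rightarrow> 'b set) \<Rightarrow> bool"
  where "cnf_partition le A a n e B \<longleftrightarrow>
    mset (cnf a) = image_mset e (mset_set {..<n}) \<and> (\<Union>p<n. B p) = A \<and>
    (\<forall>p<n. has_rank (nle le) (B p) (oexp_omega (e p))) \<and>
    (\<forall>p q. p < q \<longrightarrow> q < n \<longrightarrow> (\<forall>u\<in>B q. \<forall>d\<in>B p. \<not> le u d)) \<and>
    (\<forall>p q. p \<le> q \<longrightarrow> q < n \<longrightarrow> e q \<le> e p)"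

lemma cnf_partition_exists:
  assumes "has_rank (nle le) A (a :: 'x::infinite ordinal)" "transp_on A le"
  shows "\<exists>n e B. cnf_partition le A a n e B"
  using indecomposable_partition_mset[of le A "mset (cnf a)"] assms
  unfolding cnf_partition_def of_cnf_mset_cnf by blast

lemma
  assumes "cnf_partition le A a n e B"
  shows cnf_partition_cnf: "mset (cnf a) = image_mset e (mset_set {..<n})"
    and cnf_partition_UN: "(\<Union>p<n. B p) = A"
    and cnf_partition_has_rank: "p < n \<Longrightarrow> has_rank (nle le) (B p) (oexp_omega (e p))"
    and cnf_partition_not_le: "p < q \<Longrightarrow> q < n \<Longrightarrow> u \<in> B q \<Longrightarrow> d \<in> B p \<Longrightarrow> \<not> le u d"
    and cnf_partition_antimono: "p \<le> q \<Longrightarrow> q < n \<Longrightarrow> e q \<le> e p"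
  using assms unfolding cnf_partition_def by blast+

lemma cnf_partition_subset: "cnf_partition le A a n e B \<Longrightarrow> p < n \<Longrightarrow> B p \<subseteq> A"
  using cnf_partition_UN by fast

lemma cnf_partition_sum:
  assumes "cnf_partition le A a n e B"
  shows "(\<Sum>p<n. oexp_omega (e p)) = a"
  using of_cnf_image_mset[of "{..<n}" e] cnf_partition_cnf[OF assms] of_cnf_mset_cnf[of a] by simp

text \<open>The elements below one \<open>x\<close> have rank less than \<open>omega^b\<close>.
  Finitely many such sets, added by natural sum, stay below this indecomposable ordinal, so the
  remainder must carry the full rank.\<close>

lemma has_rank_avoid_downset:
  assumes rk: "has_rank (nle le) A (oexp_omega (b :: 'x::infinite ordinal))" and "b \<noteq> 0"
    and trans: "transp_on A le" and F: "finite F" "F \<subseteq> A"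
  shows "has_rank (nle le) {y \<in> A. \<forall>x\<in>F. \<not> le y x} (oexp_omega b)"
proof -
  let ?R = "{y \<in> A. \<forall>x\<in>F. \<not> le y x}"
  obtain v where v: "v \<le> oexp_omega b" "has_rank (nle le) ?R v"
    using has_rank_subset[OF rk, of ?R] by auto
  have one: "1 < oexp_omega b"
    using oexp_omega_less_mono[of 0 b] \<open>b \<noteq> 0\<close> by (simp add: ordinal_zero_less_iff)
  have "\<exists>c. c < oexp_omega b \<and> rank_le (nle le) {y \<in> A. le y x} c" if x: "x \<in> F" for x
  proof -
    obtain c where c: "c < oexp_omega b" "rank_le (nle le) {y \<in> A. \<not> le x y} c"
      using rank_leD[of "nle le" A "oexp_omega b" x] rk x F unfolding has_rank_def by auto
    \<comment> \<open>Elements below \<open>x\<close> are either not above \<open>x\<close> or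
      equivalent to \<open>x\<close>; the equivalent ones allow a single move.\<close>
    have "rank_le (nle le) {y \<in> A. le x y \<and> le y x} 1"
    proof (rule rank_leI)
      fix z assume z: "z \<in> {y \<in> A. le x y \<and> le y x}"
      then have "{y \<in> {y \<in> A. le x y \<and> le y x}. \<not> le z y} = {}"
        using trans x F by (auto dest: transp_onD)
      then have "rank_le (nle le) {y \<in> {y \<in> A. le x y \<and> le y x}. \<not> le z y} 0"
        by (simp only: rank_le_empty)
      then show "\<exists>b<1. rank_le (nle le) {y \<in> {y \<in> A. le x y \<and> le y x}. \<not> le z y} b"
        using ordinal_less_one_iff by blast
    qed
    then have "rank_le (nle le) ({y \<in> A. \<not> le x y} \<union> {y \<in> A. le x y \<and> le y x}) (c + 1)"
      using c(2) by (intro rank_le_Un)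
    then have "rank_le (nle le) {y \<in> A. le y x} (c + 1)"
      by (rule rank_le_mono) auto
    then show ?thesis using add_less_oexp_omega[OF c(1) one] by blast
  qed
  then obtain f where f: "\<And>x. x \<in> F \<Longrightarrow> f x < oexp_omega b"
    "\<And>x. x \<in> F \<Longrightarrow> rank_le (nle le) {y \<in> A. le y x} (f x)" by metis
  have "rank_le (nle le) (?R \<union> (\<Union>x\<in>F. {y \<in> A. le y x})) (v + (\<Sum>x\<in>F. f x))"
    using v F f by (intro rank_le_Un rank_le_UN) (auto simp: has_rank_def)
  then have "rank_le (nle le) A (v + (\<Sum>x\<in>F. f x))"
    by (rule rank_le_mono) auto
  then have "oexp_omega b \<le> v + (\<Sum>x\<in>F. f x)"
    using rk rank_ge_le_rank_le unfolding has_rank_def by blast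
  moreover have "(\<Sum>x\<in>F. f x) < oexp_omega b" using f(1) by (rule sum_less_oexp_omega)
  ultimately have "\<not> v < oexp_omega b" using add_less_oexp_omega by (meson leD)
  then show ?thesis using v by simp
qed

section \<open>Products\<close>

abbreviation (input) incomp :: "('b \<Rightarrow> 'b \<Rightarrow> bool) \<Rightarrow> 'b \<Rightarrow> 'b \<Rightarrow> bool" where
  "incomp le \<equiv> \<lambda>x y. \<not> le x y \<and> \<not> le y x"

text \<open>An element not above \<open>f\<close> fails in some coordinate \<open>k\<close>, hence
  has its \<open>k\<close>-entry in the residual of \<open>f k\<close>. That residual splits into
  pieces with exponents below \<open>b k\<close>, and finitely many powers with smaller exponents
  sum to less than the power of the total.\<close>

lemma rank_le_prod_indecomposable:
  fixes b :: "nat \<Rightarrow> 'x::infinite ordinal"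
  assumes "finite I" "\<And>k. k \<in> I \<Longrightarrow> transp_on (A k) (le k)"
    and "\<And>k. k \<in> I \<Longrightarrow> rank_le (nle (le k)) (A k) (oexp_omega (b k))"
  shows "rank_le (nle (prod_le I le)) (Pi\<^sub>E I A) (oexp_omega (\<Sum>k\<in>I. b k))"
  using assms
proof (induction "\<Sum>k\<in>I. b k" arbitrary: A b rule: less_induct)
  case less
  let ?s = "\<Sum>k\<in>I. b k"
  let ?Q = "nle (prod_le I le)"
  show ?case
  proof (rule rank_leI)
    fix f assume f: "f \<in> Pi\<^sub>E I A"
    have "\<exists>r. r < oexp_omega ?s \<and> rank_le ?Q (Pi\<^sub>E I (A(k := {y \<in> A k. \<not> le k (f k) y}))) r"
      if k: "k \<in> I" for k
    proof -
      let ?X = "{y \<in> A k. \<not> le k (f k) y}"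
      have "f k \<in> A k" using f k by auto
      then obtain c where c: "c < oexp_omega (b k)" "rank_le (nle (le k)) ?X c"
        using rank_leD[OF less.prems(3)[OF k]] by auto
      obtain c' where c': "c' \<le> c" "has_rank (nle (le k)) ?X c'"
        using c(2) by (rule has_rank_exists)
      have "transp_on ?X (le k)" using less.prems(2)[OF k] by (rule transp_on_subset) auto
      then obtain n e B where part: "cnf_partition (le k) ?X c' n e B"
        using cnf_partition_exists[OF c'(2)] by blast
      note cnf = cnf_partition_cnf[OF part] and UN = cnf_partition_UN[OF part]
        and rk = cnf_partition_has_rank[OF part]
      have e: "e p < b k" if "p < n" for p
      proof -
        have "c' < oexp_omega (b k)" using c c' by simp
        then show ?thesis using cnf that unfolding less_oexp_omega_iff_cnf by simp
      qed
      have "rank_le ?Q (Pi\<^sub>E I (A(k := B p))) (oexp_omega (\<Sum>i\<in>I. (b(k := e p)) i))"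
        if p: "p < n" for p
      proof (rule less.hyps)
        show "(\<Sum>i\<in>I. (b(k := e p)) i) < ?s"
          using e[OF p] by (intro sum_fun_upd_less less.prems k)
        have "B p \<subseteq> A k" using cnf_partition_subset[OF part p] by auto
        then show "transp_on ((A(k := B p)) i) (le i)" if "i \<in> I" for i
          using less.prems(2)[OF that] by (auto intro: transp_on_subset)
        show "rank_le (nle (le i)) ((A(k := B p)) i) (oexp_omega ((b(k := e p)) i))" if "i \<in> I" for i
          using less.prems(3)[OF that] rk[OF p] by (auto simp: has_rank_def)
      qed (rule less.prems)
      then have "rank_le ?Q (\<Union>p\<in>{..<n}. Pi\<^sub>E I (A(k := B p)))
          (\<Sum>p<n. oexp_omega (\<Sum>i\<in>I. (b(k := e p)) i))"
        by (intro rank_le_UN) auto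
      then have "rank_le ?Q (Pi\<^sub>E I (A(k := ?X))) (\<Sum>p<n. oexp_omega (\<Sum>i\<in>I. (b(k := e p)) i))"
      proof (rule rank_le_mono)
        show "Pi\<^sub>E I (A(k := ?X)) \<subseteq> (\<Union>p\<in>{..<n}. Pi\<^sub>E I (A(k := B p)))"
        proof
          fix g assume g: "g \<in> Pi\<^sub>E I (A(k := ?X))"
          then have "g k \<in> ?X" using k by (auto simp: PiE_iff)
          then obtain p where p: "p < n" "g k \<in> B p" using UN by blast
          then have "g \<in> Pi\<^sub>E I (A(k := B p))" using g by (auto simp: PiE_iff)
          then show "g \<in> (\<Union>p\<in>{..<n}. Pi\<^sub>E I (A(k := B p)))" using p(1) by blast
        qed
      qed auto
      moreover have "(\<Sum>p<n. oexp_omega (\<Sum>i\<in>I. (b(k := e p)) i)) < oexp_omega ?s"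
        using sum_fun_upd_less[OF less.prems(1) k] e by (intro sum_less_oexp_omega) auto
      ultimately show ?thesis by blast
    qed
    then have "\<forall>k\<in>I. \<exists>r. r < oexp_omega ?s \<and>
        rank_le ?Q (Pi\<^sub>E I (A(k := {y \<in> A k. \<not> le k (f k) y}))) r" by blast
    from bchoice[OF this] obtain r where r: "\<And>k. k \<in> I \<Longrightarrow> r k < oexp_omega ?s"
      "\<And>k. k \<in> I \<Longrightarrow> rank_le ?Q (Pi\<^sub>E I (A(k := {y \<in> A k. \<not> le k (f k) y}))) (r k)"
      by blast
    have "rank_le ?Q (\<Union>k\<in>I. Pi\<^sub>E I (A(k := {y \<in> A k. \<not> le k (f k) y}))) (\<Sum>k\<in>I. r k)"
      using less.prems(1) r(2) by (rule rank_le_UN)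
    then have "rank_le ?Q {g \<in> Pi\<^sub>E I A. \<not> prod_le I le f g} (\<Sum>k\<in>I. r k)"
      by (rule rank_le_mono) (auto simp: prod_le_def PiE_iff)
    moreover have "(\<Sum>k\<in>I. r k) < oexp_omega ?s" using r(1) by (rule sum_less_oexp_omega)
    ultimately show "\<exists>c. c < oexp_omega ?s \<and> rank_le ?Q {g \<in> Pi\<^sub>E I A. \<not> prod_le I le f g} c"
      by blast
  qed
qed

text \<open>Distributivity: each \<open>p\<close> chooses one term per factor, and so one product of
  pieces.\<close>

lemma prod_sum_oexp_omega:
  fixes e :: "nat \<Rightarrow> nat \<Rightarrow> 'x::infinite ordinal"
  assumes "finite I"
  shows "(\<Prod>k\<in>I. \<Sum>p<n k. oexp_omega (e k p))
    = (\<Sum>p\<in>Pi\<^sub>E I (\<lambda>k. {..<n k}). oexp_omega (\<Sum>k\<in>I. e k (p k)))"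
  using assms by (simp add: prod_sum_PiE oexp_omega_sum)

lemma rank_le_prod:
  fixes a :: "nat \<Rightarrow> 'x::infinite ordinal"
  assumes "finite I" "\<And>k. k \<in> I \<Longrightarrow> transp_on (A k) (le k)"
    and "\<And>k. k \<in> I \<Longrightarrow> has_rank (nle (le k)) (A k) (a k)"
  shows "rank_le (nle (prod_le I le)) (Pi\<^sub>E I A) (\<Prod>k\<in>I. a k)"
proof -
  have "\<forall>k\<in>I. \<exists>n e B. cnf_partition (le k) (A k) (a k) n e B"
    using cnf_partition_exists assms(2,3) by blast
  then obtain n e B where part: "\<And>k. k \<in> I \<Longrightarrow> cnf_partition (le k) (A k) (a k) (n k) (e k) (B k)"
    by metis
  note a = cnf_partition_sum[OF part] and A = cnf_partition_UN[OF part]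
    and rk = cnf_partition_has_rank[OF part]
  let ?S = "Pi\<^sub>E I (\<lambda>k. {..<n k})"
  have sub: "B k (p k) \<subseteq> A k" if "p \<in> ?S" "k \<in> I" for p k
    using that cnf_partition_subset[OF part, of k "p k"] by (auto simp: PiE_iff)
  have "rank_le (nle (prod_le I le)) (\<Union>p\<in>?S. Pi\<^sub>E I (\<lambda>k. B k (p k)))
      (\<Sum>p\<in>?S. oexp_omega (\<Sum>k\<in>I. e k (p k)))"
  proof (rule rank_le_UN)
    show "finite ?S" using assms(1) by (intro finite_PiE) auto
    fix p assume p: "p \<in> ?S"
    show "rank_le (nle (prod_le I le)) (Pi\<^sub>E I (\<lambda>k. B k (p k))) (oexp_omega (\<Sum>k\<in>I. e k (p k)))"
    proof (rule rank_le_prod_indecomposable)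
      fix k assume k: "k \<in> I"
      show "transp_on (B k (p k)) (le k)"
        using assms(2)[OF k] sub[OF p k] by (rule transp_on_subset)
      show "rank_le (nle (le k)) (B k (p k)) (oexp_omega (e k (p k)))"
        using rk[OF k, of "p k"] p k by (auto simp: has_rank_def PiE_iff)
    qed (rule assms)
  qed
  then have "rank_le (nle (prod_le I le)) (Pi\<^sub>E I A) (\<Sum>p\<in>?S. oexp_omega (\<Sum>k\<in>I. e k (p k)))"
  proof (rule rank_le_mono)
    show "Pi\<^sub>E I A \<subseteq> (\<Union>p\<in>?S. Pi\<^sub>E I (\<lambda>k. B k (p k)))"
    proof
      fix f assume f: "f \<in> Pi\<^sub>E I A"
      have "\<exists>p. p < n k \<and> f k \<in> B k p" if "k \<in> I" for k
      proof -
        have "f k \<in> (\<Union>p<n k. B k p)" using A[OF that] f that by auto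
        then show ?thesis by blast
      qed
      then obtain p where p: "\<And>k. k \<in> I \<Longrightarrow> p k < n k \<and> f k \<in> B k (p k)" by metis
      then have "restrict p I \<in> ?S" "f \<in> Pi\<^sub>E I (\<lambda>k. B k (restrict p I k))"
        using f by (auto simp: PiE_iff)
      then show "f \<in> (\<Union>p\<in>?S. Pi\<^sub>E I (\<lambda>k. B k (p k)))" by blast
    qed
  qed auto
  moreover have "(\<Prod>k\<in>I. a k) = (\<Sum>p\<in>?S. oexp_omega (\<Sum>k\<in>I. e k (p k)))"
    using prod_sum_oexp_omega[OF assms(1), of e n] a by simp
  ultimately show ?thesis by simp
qed

section \<open>Lower bound: long sequences of incomparable elements in a product\<close>

text \<open>Blocks are played in increasing order of the exponent \<^term>\<open>g\<close>, ties being broken by decreasing \<^term>\<open>h\<close>.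
  A later block lies below or beside the earlier ones in a coordinate other than \<^term>\<open>j\<close>, and moves
  upwards in the indecomposable coordinate \<^term>\<open>j\<close>, where a finite set of moves exhausts nothing.\<close>
lemma rank_ge_blocks:
  fixes g :: "'p \<Rightarrow> 'x::infinite ordinal" and h :: "'p \<Rightarrow> nat"
  assumes "finite S" "j \<in> I" and trans: "transp_on Aj (le j)"
    and rk: "has_rank (nle (le j)) Aj (oexp_omega b)" and "b \<noteq> 0"
    and order: "\<And>p q. p \<in> S \<Longrightarrow> q \<in> S \<Longrightarrow> p \<noteq> q \<Longrightarrow> g q < g p \<or> g q = g p \<and> h p \<le> h q \<Longrightarrow>
      \<exists>k\<in>I - {j}. \<forall>u\<in>BB q k. \<forall>d\<in>BB p k. \<not> le k u d"
    and block: "\<And>p A'. p \<in> S \<Longrightarrow> A' \<subseteq> Aj \<Longrightarrow> has_rank (nle (le j)) A' (oexp_omega b) \<Longrightarrow>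
      rank_ge (incomp (prod_le I le)) (Pi\<^sub>E I ((BB p)(j := A'))) (oexp_omega (g p))"
  shows "rank_ge (incomp (prod_le I le)) (\<Union>p\<in>S. Pi\<^sub>E I ((BB p)(j := Aj))) (\<Sum>p\<in>S. oexp_omega (g p))"
  using assms(1) order block
proof (induction S rule: finite_psubset_induct)
  case (psubset S)
  let ?N = "incomp (prod_le I le)"
  show ?case
  proof (cases "S = {}")
    case False
    \<comment> \<open>The block \<open>p0\<close> played last has the largest exponent and, among
      ties, the least \<open>h\<close>, so \<open>order\<close> compares it with every other
      block.\<close>
    define G where "G = Max (g ` S)"
    define S' where "S' = {p \<in> S. g p = G}"
    have "G \<in> g ` S" using False psubset.hyps by (simp add: G_def)
    then have S': "S' \<noteq> {}" "finite S'" using psubset.hyps by (auto simp: S'_def)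
    then obtain p0 where p0: "p0 \<in> S'" "\<And>p. p \<in> S' \<Longrightarrow> h p0 \<le> h p"
      using ex_min_if_finite[of "h ` S'"] by (metis arg_min_if_finite(1) arg_min_least)
    then have p0S: "p0 \<in> S" "g p0 = G" by (auto simp: S'_def)
    have G: "g q \<le> G" if "q \<in> S" for q using that psubset.hyps by (simp add: G_def)
    let ?X = "Pi\<^sub>E I ((BB p0)(j := Aj))"
    let ?Y = "\<Union>p\<in>S - {p0}. Pi\<^sub>E I ((BB p)(j := Aj))"
    have "rank_ge ?N (?X \<union> ?Y) (oadd (oexp_omega G) (\<Sum>p\<in>S - {p0}. oexp_omega (g p)))"
    proof (rule rank_ge_Un_avoiding)
      show "rank_ge ?N ?Y (\<Sum>p\<in>S - {p0}. oexp_omega (g p))"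
        using p0S psubset.prems by (intro psubset.IH) auto
    next
      fix F assume F: "finite F" "F \<subseteq> ?Y"
      \<comment> \<open>The part of \<open>Aj\<close> not below any \<open>j\<close>-entry already
        played; it keeps the full rank, so \<open>block\<close> applies to it.\<close>
      define A' where "A' = {y \<in> Aj. \<forall>x\<in>(\<lambda>f. f j) ` F. \<not> le j y x}"
      have sub: "A' \<subseteq> Aj" by (auto simp: A'_def)
      have "(\<lambda>f. f j) ` F \<subseteq> Aj" using F(2) \<open>j \<in> I\<close> by (fastforce simp: PiE_iff)
      then have "has_rank (nle (le j)) A' (oexp_omega b)"
        unfolding A'_def using F(1) by (intro has_rank_avoid_downset rk \<open>b \<noteq> 0\<close> trans) auto
      then have "rank_ge ?N (Pi\<^sub>E I ((BB p0)(j := A'))) (oexp_omega G)"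
        using psubset.prems(2)[OF p0S(1) sub] p0S(2) by metis
      then show "rank_ge ?N {x \<in> ?X. \<forall>y\<in>F. ?N y x} (oexp_omega G)"
      proof (rule rank_ge_mono)
        show "Pi\<^sub>E I ((BB p0)(j := A')) \<subseteq> {x \<in> ?X. \<forall>y\<in>F. ?N y x}"
        proof (intro subsetI CollectI conjI ballI)
          fix x assume x: "x \<in> Pi\<^sub>E I ((BB p0)(j := A'))"
          then show "x \<in> ?X" by (fastforce simp: PiE_iff A'_def split: if_splits)
          fix y assume y: "y \<in> F"
          then obtain q where q: "q \<in> S" "q \<noteq> p0" "y \<in> Pi\<^sub>E I ((BB q)(j := Aj))"
            using F(2) by blast
          have "g q < g p0 \<or> g q = g p0 \<and> h p0 \<le> h q"
            using G[OF q(1)] p0S p0(2)[of q] q(1) by (auto simp: S'_def)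
          then obtain k where k: "k \<in> I - {j}" "\<forall>u\<in>BB q k. \<forall>d\<in>BB p0 k. \<not> le k u d"
            using psubset.prems(1)[OF p0S(1) q(1)] q(2) by metis
          moreover have "y k \<in> BB q k" "x k \<in> BB p0 k"
            using k(1) x q(3) by (auto simp: PiE_iff)
          ultimately have "\<not> le k (y k) (x k)" by blast
          then show "\<not> prod_le I le y x" using k(1) by (auto simp: prod_le_def)
          have "x j \<in> A'" using x \<open>j \<in> I\<close> by (auto simp: PiE_iff)
          then have "\<not> le j (x j) (y j)" using y by (auto simp: A'_def)
          then show "\<not> prod_le I le x y" using \<open>j \<in> I\<close> by (auto simp: prod_le_def)
        qed
      qed simp
    qed
    moreover have "?X \<union> ?Y = (\<Union>p\<in>S. Pi\<^sub>E I ((BB p)(j := Aj)))" using p0S by blast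
    \<comment> \<open>Since \<open>G\<close> is maximal, its power in front absorbs nothing and is
      not absorbed; the order of play thus yields a natural sum.\<close>
    moreover have "oadd (oexp_omega G) (\<Sum>p\<in>S - {p0}. oexp_omega (g p)) = (\<Sum>p\<in>S. oexp_omega (g p))"
    proof -
      let ?M = "image_mset g (mset_set (S - {p0}))"
      have "of_cnf (add_mset G ?M) = oadd (oexp_omega G) (of_cnf ?M)"
        using G psubset.hyps by (intro of_cnf_add_max) auto
      then show ?thesis
        using psubset.hyps p0S by (simp add: of_cnf_add_mset of_cnf_image_mset sum.remove[of S p0])
    qed
    ultimately show ?thesis by metis
  qed simp
qed

text \<open>Two coordinates carry the exponent \<open>1 + c\<close> because the recursion on the exponents must always
  leave a second unbounded coordinate to escape along. For infinite \<open>c\<close> nothing is lost.\<close>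
lemma rank_ge_prod_indecomposable:
  fixes c :: "nat \<Rightarrow> 'x::infinite ordinal"
  assumes "finite I" "j1 \<in> I" "j2 \<in> I" "j1 \<noteq> j2"
    and "\<And>k. k \<in> I \<Longrightarrow> transp_on (A k) (le k)"
    and "\<And>k. k \<in> I \<Longrightarrow> has_rank (nle (le k)) (A k)
      (oexp_omega (if k = j1 \<or> k = j2 then oadd oone (c k) else c k))"
  shows "rank_ge (incomp (prod_le I le)) (Pi\<^sub>E I A) (oexp_omega (\<Sum>k\<in>I. c k))"
  using assms(5,6)
proof (induction "\<Sum>k\<in>I. c k" arbitrary: A c rule: less_induct)
  case less
  let ?s = "\<Sum>k\<in>I. c k"
  let ?N = "incomp (prod_le I le)"
  \<comment> \<open>The actual exponents. Adding 1 on the left is strictly monotone, never gives 0,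
    and is absorbed by infinite exponents.\<close>
  define bb where "bb c k = (if k = j1 \<or> k = j2 then oadd oone (c k) else c k)"
    for c :: "nat \<Rightarrow> 'x ordinal" and k
  have rk: "has_rank (nle (le k)) (A k) (oexp_omega (bb c k))" if "k \<in> I" for k
    using less.prems(2)[OF that] by (simp add: bb_def)
  have "\<exists>x. x \<in> A k" if "k \<in> I" for k
    using rk[OF that] rank_geD[OF _ oexp_omega_pos[of "bb c k"], of "nle (le k)" "A k"]
    by (auto simp: has_rank_def)
  then obtain a where a: "\<And>k. k \<in> I \<Longrightarrow> a k \<in> A k" by metis
  show ?case
  proof (rule rank_geI)
    fix d assume d: "d < oexp_omega ?s"
    show "\<exists>f\<in>Pi\<^sub>E I A. rank_ge ?N {g \<in> Pi\<^sub>E I A. ?N f g} d"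
    proof (cases "?s = 0")
      case True
      then have "d = 0" using d by simp
      moreover have "restrict a I \<in> Pi\<^sub>E I A" using a by auto
      ultimately show ?thesis by (intro bexI[of _ "restrict a I"]) simp_all
    next
      case False
      \<comment> \<open>The target \<open>d\<close> is reduced to \<open>n\<close> copies of one
        smaller power, and \<open>s\<close> is then reached by lowering a single exponent
        \<open>c i\<close> to \<open>c'\<close>.\<close>
      then obtain s n where s: "s < ?s" "d \<le> of_cnf (replicate_mset n s)"
        using d by (elim less_oexp_omega_replicateE)
      obtain i c' where i: "i \<in> I" "c' < c i" "s \<le> (\<Sum>k\<in>I. (c(i := c')) k)"
        using less_sum_ordinalE[OF assms(1) s(1)] by blast
      define cc where "cc = c(i := c')"
      have cc_less: "(\<Sum>k\<in>I. cc k) < ?s"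
        unfolding cc_def using i assms(1) by (intro sum_fun_upd_less)
      have bi: "bb cc i < bb c i" using i(2) by (simp add: bb_def cc_def)
      have bb_eq: "bb cc k = bb c k" if "k \<noteq> i" for k using that by (simp add: bb_def cc_def)
      \<comment> \<open>One of \<open>j1\<close>, \<open>j2\<close> differs from \<open>i\<close>;
        its exponent contains the extra 1, so finite sets of moves can be avoided there.\<close>
      obtain j where j: "j \<in> I" "j \<noteq> i" "j = j1 \<or> j = j2" using assms(2-4) by metis
      have "oone \<le> oadd oone (c j)" by (rule le_oadd_left)
      then have bj: "bb c j \<noteq> 0" using j(3) by (auto simp: bb_def oone_le_iff ozero_eq_zero)
      \<comment> \<open>A first move \<open>x\<close> in coordinate \<open>i\<close> is to leave
        room for \<open>n\<close> pieces, each with the lowered exponent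
        \<open>bb cc i\<close>.\<close>
      let ?M = "replicate_mset n (bb cc i)"
      have "of_cnf ?M < oexp_omega (bb c i)"
        using bi by (simp add: less_oexp_omega_iff_cnf del: set_mset_mset)
      then obtain x where x: "x \<in> A i" "rank_ge (nle (le i)) {y \<in> A i. \<not> le i x y} (of_cnf ?M)"
        using rk[OF i(1)] rank_geD[of "nle (le i)" "A i" "oexp_omega (bb c i)" "of_cnf ?M"]
        by (auto simp: has_rank_def)
      let ?X = "{y \<in> A i. \<not> le i x y}"
      have trX: "transp_on ?X (le i)" using less.prems(1)[OF i(1)] by (rule transp_on_subset) auto
      obtain r :: "'x ordinal" where r: "has_rank (nle (le i)) ?X r"
        using has_rank_subset[OF rk[OF i(1)], of ?X] by auto
      then have "of_cnf ?M \<le> r"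
        using x(2) rank_ge_le_rank_le unfolding has_rank_def by blast
      with r obtain D where D: "D \<subseteq> ?X" "has_rank (nle (le i)) D (of_cnf ?M)"
        by (rule has_rank_downset[OF _ _ trX])
      have "transp_on D (le i)" using trX D(1) by (rule transp_on_subset)
      then obtain n' e B where part: "cnf_partition (le i) D (of_cnf ?M) n' e B"
        using cnf_partition_exists[OF D(2)] by blast
      have M: "?M = image_mset e (mset_set {..<n'})" using cnf_partition_cnf[OF part] by simp
      have n': "n' = n" using arg_cong[OF M, of size] by simp
      have e: "e p = bb cc i" if "p < n" for p
      proof -
        have "e p \<in># image_mset e (mset_set {..<n'})" using that n' by simp
        then show ?thesis unfolding M[symmetric] by (metis in_replicate_mset)
      qed
      have Bsub: "B p \<subseteq> ?X" if "p < n" for p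
        using cnf_partition_subset[OF part] D(1) that n' by blast
      \<comment> \<open>The first move of the sequence: \<open>x\<close> in coordinate
        \<open>i\<close>, arbitrary elements elsewhere. Later moves will be not above it at
        \<open>i\<close> and, inside \<open>Aj\<close>, not below it at \<open>j\<close>.\<close>
      define f where "f = restrict (a(i := x)) I"
      have f: "f \<in> Pi\<^sub>E I A" "f i = x" "f j \<in> A j" using a x(1) i(1) j(1,2) by (auto simp: f_def)
      define Aj where "Aj = {y \<in> A j. \<forall>z\<in>{f j}. \<not> le j y z}"
      have rkAj: "has_rank (nle (le j)) Aj (oexp_omega (bb c j))"
        unfolding Aj_def using rk[OF j(1)] bj less.prems(1)[OF j(1)] f(3)
        by (intro has_rank_avoid_downset) auto
      have trAj: "transp_on Aj (le j)"
        using less.prems(1)[OF j(1)] by (rule transp_on_subset) (auto simp: Aj_def)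
      have blocks: "rank_ge ?N (\<Union>p\<in>{..<n}. Pi\<^sub>E I ((A(i := B p))(j := Aj))) (\<Sum>p<n. oexp_omega (\<Sum>k\<in>I. cc k))"
      \<comment> \<open>All blocks have the same exponent, so the piece index breaks the ties:
        higher pieces of \<open>D\<close> are played first.\<close>
      proof (rule rank_ge_blocks[where h = id and le = le and BB = "\<lambda>p. A(i := B p)", OF _ j(1) trAj rkAj bj])
        fix p q assume pq: "p \<in> {..<n}" "q \<in> {..<n}" "p \<noteq> q"
          and "(\<Sum>k\<in>I. cc k) < (\<Sum>k\<in>I. cc k) \<or> (\<Sum>k\<in>I. cc k) = (\<Sum>k\<in>I. cc k) \<and> id p \<le> id q"
        then have "p < q" by simp
        then have "\<forall>u\<in>B q. \<forall>d\<in>B p. \<not> le i u d"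
          using cnf_partition_not_le[OF part] pq(2) n' by blast
        then show "\<exists>k\<in>I - {j}. \<forall>u\<in>(A(i := B q)) k. \<forall>d\<in>(A(i := B p)) k. \<not> le k u d"
          using i(1) j(2) by (intro bexI[of _ i]) auto
      next
        fix p A' assume p: "p \<in> {..<n}" and A': "A' \<subseteq> Aj" "has_rank (nle (le j)) A' (oexp_omega (bb c j))"
        show "rank_ge ?N (Pi\<^sub>E I ((A(i := B p))(j := A'))) (oexp_omega (\<Sum>k\<in>I. cc k))"
        proof (rule less.hyps[OF cc_less])
          fix k assume k: "k \<in> I"
          have "A' \<subseteq> A j" using A'(1) by (auto simp: Aj_def)
          moreover have "B p \<subseteq> A i" using Bsub p by blast
          ultimately have "((A(i := B p))(j := A')) k \<subseteq> A k" by simp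
          with less.prems(1)[OF k] show "transp_on (((A(i := B p))(j := A')) k) (le k)"
            by (rule transp_on_subset)
          have "has_rank (nle (le k)) (((A(i := B p))(j := A')) k) (oexp_omega (bb cc k))"
          proof -
            consider "k = j" | "k = i" | "k \<noteq> j" "k \<noteq> i" by blast
            then show ?thesis
            proof cases
              case 1
              then show ?thesis using A'(2) bb_eq[of j] j(2) by simp
            next
              case 2
              then show ?thesis
                using cnf_partition_has_rank[OF part, of p] e[of p] p n' j(2) by simp
            next
              case 3
              then show ?thesis using rk[OF k] bb_eq[of k] by simp
            qed
          qed
          then show "has_rank (nle (le k)) (((A(i := B p))(j := A')) k)
              (oexp_omega (if k = j1 \<or> k = j2 then oadd oone (cc k) else cc k))"
            unfolding bb_def .
        qed
      qed simp
      have d_le: "d \<le> (\<Sum>p<n. oexp_omega (\<Sum>k\<in>I. cc k))"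
      proof -
        have "of_cnf (replicate_mset n s) \<le> of_cnf (replicate_mset n (\<Sum>k\<in>I. cc k))"
          using i(3) by (simp add: cc_def replicate_mset_mono)
        also have "\<dots> = (\<Sum>p<n. oexp_omega (\<Sum>k\<in>I. cc k))"
          using of_cnf_image_mset[of "{..<n}" "\<lambda>_. \<Sum>k\<in>I. cc k"] by (simp add: image_mset_const_eq)
        finally show ?thesis using s(2) by simp
      qed
      have sub: "(\<Union>p\<in>{..<n}. Pi\<^sub>E I ((A(i := B p))(j := Aj))) \<subseteq> {g \<in> Pi\<^sub>E I A. ?N f g}"
      proof
        fix g assume "g \<in> (\<Union>p\<in>{..<n}. Pi\<^sub>E I ((A(i := B p))(j := Aj)))"
        then obtain p where p: "p < n" and g: "g \<in> Pi\<^sub>E I ((A(i := B p))(j := Aj))" by blast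
        have gk: "g k \<in> ((A(i := B p))(j := Aj)) k" if "k \<in> I" for k using g that by (rule PiE_mem)
        have gi: "g i \<in> ?X" using gk[OF i(1)] j(2) Bsub[OF p] by auto
        have gj: "g j \<in> Aj" using gk[OF j(1)] by simp
        have "g k \<in> A k" if "k \<in> I" for k
          using gk[OF that] gi gj by (cases "k = i"; cases "k = j") (auto simp: Aj_def)
        then have "g \<in> Pi\<^sub>E I A" using g by (auto simp: PiE_iff)
        moreover have "\<not> prod_le I le f g" using gi f(2) i(1) by (auto simp: prod_le_def)
        moreover have "\<not> prod_le I le g f" using gj j(1) by (auto simp: prod_le_def Aj_def)
        ultimately show "g \<in> {g \<in> Pi\<^sub>E I A. ?N f g}" by simp
      qed
      have "rank_ge ?N {g \<in> Pi\<^sub>E I A. ?N f g} d" by (rule rank_ge_mono[OF blocks sub d_le])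
      then show ?thesis using f(1) by blast
    qed
  qed
qed

text \<open>The products of pieces serve as blocks and \<open>i\<close> as the escape coordinate;
  distributivity turns the sum of their powers into the product of the types.\<close>

lemma rank_ge_prod:
  fixes a :: "nat \<Rightarrow> 'x::infinite ordinal"
  assumes fin: "finite I" and trans: "\<And>k. k \<in> I \<Longrightarrow> transp_on (A k) (le k)"
    and rank: "\<And>k. k \<in> I \<Longrightarrow> has_rank (nle (le k)) (A k) (a k)"
    and i: "i \<in> I" "infinite_indecomposable (a i)"
    and j: "j1 \<in> I" "j2 \<in> I" "j1 \<noteq> j2"
      "all_cnf_exponents_infinite (a j1)" "all_cnf_exponents_infinite (a j2)"
  shows "rank_ge (incomp (prod_le I le)) (Pi\<^sub>E I A) (\<Prod>k\<in>I. a k)"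
proof -
  let ?N = "incomp (prod_le I le)"
  have "\<forall>k\<in>I. \<exists>n e B. cnf_partition (le k) (A k) (a k) n e B"
    using cnf_partition_exists trans rank by blast
  then obtain n e B where part: "\<And>k. k \<in> I \<Longrightarrow> cnf_partition (le k) (A k) (a k) (n k) (e k) (B k)"
    by metis
  note cnf = cnf_partition_cnf[OF part]
  let ?S = "Pi\<^sub>E I (\<lambda>k. {..<n k})"
  obtain b where b: "oone \<le> b" "a i = oexp_omega b" using i(2) unfolding infinite_indecomposable_def by blast
  then have b0: "b \<noteq> 0" by (simp add: oone_le_iff ozero_eq_zero)
  \<comment> \<open>A single power has one exponent, so coordinate \<open>i\<close> is not split:
    its only piece is \<open>A i\<close>, and distinct blocks differ elsewhere.\<close>
  have ni: "n i = 1" using arg_cong[OF cnf[OF i(1)], of size] b(2) arg_cong[OF mset_cnf_oexp_omega[of b], of size]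
    by simp
  have ei: "e i 0 = b" using cnf[OF i(1)] mset_cnf_oexp_omega[of b] b(2) ni by (simp add: lessThan_Suc)
  have Bi: "B i 0 = A i" using cnf_partition_UN[OF part[OF i(1)]] ni by (simp add: lessThan_Suc)
  have large: "oomega \<le> e k p" if "k = j1 \<or> k = j2" "p < n k" for k p
  proof -
    have k: "k \<in> I" using that j by auto
    have "e k p \<in># mset (cnf (a k))" using that(2) unfolding cnf[OF k] by simp
    then show ?thesis using that j unfolding all_cnf_exponents_infinite_def by auto
  qed
  have lt: "p k < n k" if "p \<in> ?S" "k \<in> I" for p k using that by auto
  have p0: "p i = 0" if "p \<in> ?S" for p using lt[OF that i(1)] ni by simp
  define g where "g p = (\<Sum>k\<in>I. e k (p k))" for p
  have "rank_ge ?N (\<Union>p\<in>?S. Pi\<^sub>E I ((\<lambda>k. B k (p k))(i := A i))) (\<Sum>p\<in>?S. oexp_omega (g p))"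
  proof (rule rank_ge_blocks[where h = "\<lambda>p. \<Sum>k\<in>I. p k" and le = le
        and BB = "\<lambda>p k. B k (p k)", OF _ i(1) trans[OF i(1)] _ b0])
    show "finite ?S" using fin by (intro finite_PiE) auto
    show "has_rank (nle (le i)) (A i) (oexp_omega b)" using rank[OF i(1)] b(2) by simp
  next
    fix p q assume pq: "p \<in> ?S" "q \<in> ?S" "p \<noteq> q"
      and ord: "g q < g p \<or> g q = g p \<and> (\<Sum>k\<in>I. p k) \<le> (\<Sum>k\<in>I. q k)"
    \<comment> \<open>If \<open>q\<close> were pointwise at most \<open>p\<close>, decreasing
      exponents would give \<open>g p \<le> g q\<close>, hence a tie; but then
      \<open>p \<noteq> q\<close> makes the index sum of \<open>q\<close> strictly smaller, against
      the tie-break.\<close>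
    have "\<exists>k\<in>I. p k < q k"
    proof (rule ccontr)
      assume "\<not> ?thesis"
      then have le: "q k \<le> p k" if "k \<in> I" for k using that by (auto simp: not_less)
      have "g p \<le> g q"
        unfolding g_def using le lt[OF pq(1)] cnf_partition_antimono[OF part] by (intro sum_mono) blast
      then have "(\<Sum>k\<in>I. p k) \<le> (\<Sum>k\<in>I. q k)" using ord by auto
      moreover have "(\<Sum>k\<in>I. q k) < (\<Sum>k\<in>I. p k)"
      proof (rule sum_strict_mono_ex1[OF fin])
        show "\<exists>k\<in>I. q k < p k"
          using pq le PiE_ext[OF pq(1,2)] by (metis order_le_less)
      qed (use le in blast)
      ultimately show False by simp
    qed
    then obtain k where k: "k \<in> I" "p k < q k" by blast
    then have "k \<noteq> i" using p0[OF pq(1)] p0[OF pq(2)] by auto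
    then show "\<exists>k\<in>I - {i}. \<forall>u\<in>B k (q k). \<forall>d\<in>B k (p k). \<not> le k u d"
      using cnf_partition_not_le[OF part[OF k(1)] k(2) lt[OF pq(2) k(1)]] k(1) by blast
  next
    fix p A' assume p: "p \<in> ?S" and A': "A' \<subseteq> A i" "has_rank (nle (le i)) A' (oexp_omega b)"
    show "rank_ge ?N (Pi\<^sub>E I ((\<lambda>k. B k (p k))(i := A'))) (oexp_omega (g p))"
      unfolding g_def
    proof (rule rank_ge_prod_indecomposable[OF fin j(1-3)])
      fix k assume k: "k \<in> I"
      have "((\<lambda>k. B k (p k))(i := A')) k \<subseteq> A k"
        using cnf_partition_subset[OF part[OF k] lt[OF p k]] A'(1) by simp
      with trans[OF k] show "transp_on (((\<lambda>k. B k (p k))(i := A')) k) (le k)"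
        by (rule transp_on_subset)
      have "has_rank (nle (le k)) (((\<lambda>k. B k (p k))(i := A')) k) (oexp_omega (e k (p k)))"
        using cnf_partition_has_rank[OF part[OF k] lt[OF p k]] A'(2) ei p0[OF p] by simp
      \<comment> \<open>The exponents in coordinates \<open>j1\<close> and \<open>j2\<close> are
        infinite, so the extra 1 is already present.\<close>
      moreover have "(if k = j1 \<or> k = j2 then oadd oone (e k (p k)) else e k (p k)) = e k (p k)"
        using oone_oadd_infinite[OF large[OF _ lt[OF p k]]] by simp
      ultimately show "has_rank (nle (le k)) (((\<lambda>k. B k (p k))(i := A')) k)
          (oexp_omega (if k = j1 \<or> k = j2 then oadd oone (e k (p k)) else e k (p k)))"
        by (simp only:)
    qed
  qed
  moreover have "(\<Union>p\<in>?S. Pi\<^sub>E I ((\<lambda>k. B k (p k))(i := A i))) \<subseteq> Pi\<^sub>E I A"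
  proof
    fix f assume "f \<in> (\<Union>p\<in>?S. Pi\<^sub>E I ((\<lambda>k. B k (p k))(i := A i)))"
    then obtain p where p: "p \<in> ?S" and f: "f \<in> Pi\<^sub>E I ((\<lambda>k. B k (p k))(i := A i))" by blast
    have "f k \<in> A k" if k: "k \<in> I" for k
      using PiE_mem[OF f k] cnf_partition_subset[OF part[OF k] lt[OF p k]]
      by (cases "k = i") auto
    then show "f \<in> Pi\<^sub>E I A" using f by (auto simp: PiE_iff)
  qed
  moreover have "(\<Prod>k\<in>I. a k) = (\<Sum>p\<in>?S. oexp_omega (g p))"
    using prod_sum_oexp_omega[OF fin, of e n] cnf_partition_sum[OF part] by (simp add: g_def)
  ultimately show ?thesis by (auto intro: rank_ge_mono)
qed

section \<open>Width of the product\<close>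

text \<open>One forest for both notions: \<open>nle\<close> gives bad sequences and
  \<open>incomp\<close> gives sequences of incomparable elements.\<close>

definition seqs :: "('b \<Rightarrow> 'b \<Rightarrow> bool) \<Rightarrow> 'b set \<Rightarrow> 'b list set" where
  "seqs Q A = {xs. xs \<noteq> [] \<and> set xs \<subseteq> A \<and> sorted_wrt Q xs}"

lemma bad_seqs_eq: "bad_seqs A le = seqs (nle le) A"
  by (auto simp: bad_seqs_def seqs_def sorted_wrt_iff_nth_less)

lemma antichain_seqs_eq: "antichain_seqs A le = seqs (incomp le) A"
proof -
  have "(\<forall>i j. i < length xs \<and> j < length xs \<and> i \<noteq> j \<longrightarrow> \<not> le (xs ! i) (xs ! j))
      \<longleftrightarrow> sorted_wrt (incomp le) xs" for xs
    unfolding sorted_wrt_iff_nth_less by (metis linorder_neqE_nat order_less_trans order_less_irrefl)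
  then show ?thesis by (auto simp: antichain_seqs_def seqs_def)
qed

text \<open>An infinite chain of proper extensions converges to an infinite sequence with all pairs
  \<open>Q\<close>-related.\<close>

lemma wf_seqs:
  assumes no_inf: "\<nexists>f :: nat \<Rightarrow> 'b. (\<forall>i. f i \<in> A) \<and> (\<forall>i j. i < j \<longrightarrow> Q (f i) (f j))"
  shows "wf {(t, s). t \<in> seqs Q A \<and> s \<in> seqs Q A \<and> strict_prefix s t}"
proof (rule ccontr)
  assume "\<not> ?thesis"
  then obtain s where s: "\<And>i. s (Suc i) \<in> seqs Q A" "\<And>i. strict_prefix (s i) (s (Suc i))"
    unfolding wf_iff_no_infinite_down_chain by auto
  have len: "i \<le> length (s i)" for i
  proof (induction i)
    case (Suc i)
    then show ?case using prefix_length_less[OF s(2), of i] by simp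
  qed simp
  have pre: "prefix (s i) (s j)" if "i \<le> j" for i j
    using that by (induction rule: dec_induct) (use s(2) in \<open>auto intro: prefix_order.trans prefix_order.less_imp_le\<close>)
  have nth: "s (Suc i) ! i = s (Suc j) ! i" if "i \<le> j" for i j
  proof -
    have "i < length (s (Suc i))" using len[of "Suc i"] by simp
    then show ?thesis using pre[of "Suc i" "Suc j"] that by (auto simp: prefix_def nth_append)
  qed
  \<comment> \<open>The limit sequence. Only \<open>i \<le> length (s i)\<close> is known, so
    \<open>Suc\<close> keeps index \<open>i\<close> in range.\<close>
  let ?f = "\<lambda>i. s (Suc i) ! i"
  have "?f i \<in> A" for i
    using s(1)[of i] len[of "Suc i"] by (auto simp: seqs_def subset_iff)
  moreover have "Q (?f i) (?f j)" if "i < j" for i j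
    using s(1)[of j] len[of "Suc j"] nth[of i j] that
    by (auto simp: seqs_def sorted_wrt_iff_nth_less)
  ultimately have "(\<forall>i. ?f i \<in> A) \<and> (\<forall>i j. i < j \<longrightarrow> Q (?f i) (?f j))" by blast
  then show False by (rule notE[OF no_inf exI[of _ ?f]])
qed

text \<open>Lets the upper bound for the product supply the well-foundedness of its forest of
  incomparable sequences.\<close>

lemma rank_le_no_infinite:
  assumes "rank_le Q A a"
  shows "\<nexists>f :: nat \<Rightarrow> 'b. (\<forall>i. f i \<in> A) \<and> (\<forall>i j. i < j \<longrightarrow> Q (f i) (f j))"
  using assms
proof (induction a arbitrary: A rule: less_induct)
  case (less a)
  show ?case
  proof
    assume "\<exists>f :: nat \<Rightarrow> 'b. (\<forall>i. f i \<in> A) \<and> (\<forall>i j. i < j \<longrightarrow> Q (f i) (f j))"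
    then obtain f :: "nat \<Rightarrow> 'b" where f: "\<And>i. f i \<in> A" "\<And>i j. i < j \<Longrightarrow> Q (f i) (f j)" by blast
    obtain b where "b < a" "rank_le Q {y \<in> A. Q (f 0) y} b"
      using rank_leD[OF less.prems f(1)] by blast
    moreover have "(\<forall>i. f (Suc i) \<in> {y \<in> A. Q (f 0) y}) \<and> (\<forall>i j. i < j \<longrightarrow> Q (f (Suc i)) (f (Suc j)))"
      using f by simp
    ultimately show False
      using less.IH[of b "{y \<in> A. Q (f 0) y}"]
      by (auto dest!: spec[of _ "\<lambda>i. f (Suc i)"])
  qed
qed

text \<open>The rank of a node \<open>s\<close> is the rank of its residual, the elements that may
  extend \<open>s\<close>. The cardinality assumption makes every \<open>osup\<close> in the
  definitions a true supremum.\<close>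

lemma has_rank_forest_rank:
  fixes Q :: "'b \<Rightarrow> 'b \<Rightarrow> bool"
  assumes card: "|UNIV :: 'b list set| \<le>o |UNIV :: 'x::infinite set|"
    and no_inf: "\<nexists>f :: nat \<Rightarrow> 'b. (\<forall>i. f i \<in> A) \<and> (\<forall>i j. i < j \<longrightarrow> Q (f i) (f j))"
  shows "has_rank Q A (forest_rank (seqs Q A) :: 'x ordinal)"
proof -
  let ?F = "seqs Q A"
  let ?R = "{(t, s). t \<in> ?F \<and> s \<in> ?F \<and> strict_prefix s t}"
  let ?rk = "node_rank ?F :: 'b list \<Rightarrow> 'x ordinal"
  have wf: "wf ?R" using no_inf by (rule wf_seqs)
  have small: "small {h t | t. P t}" for h :: "'b list \<Rightarrow> 'x ordinal" and P
  proof -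
    have "{h t | t. P t} = h ` Collect P" by auto
    then have 1: "|{h t | t. P t}| \<le>o |Collect P|" by (simp add: card_of_image)
    have 2: "|Collect P| \<le>o |UNIV :: 'b list set|" by (rule card_of_mono1) simp
    show ?thesis
      unfolding small_def by (rule ordLeq_transitive[OF 1 ordLeq_transitive[OF 2 card]])
  qed
  have rec: "?rk s = osup {osucc (?rk t) | t. t \<in> ?F \<and> strict_prefix s t}" if s: "s \<in> ?F" for s
  proof -
    have "?rk s = osup {osucc (cut ?rk ?R s t) | t. t \<in> ?F \<and> strict_prefix s t}"
      unfolding node_rank_def by (subst wfrec[OF wf]) (rule refl)
    also have "{osucc (cut ?rk ?R s t) | t. t \<in> ?F \<and> strict_prefix s t}
        = {osucc (?rk t) | t. t \<in> ?F \<and> strict_prefix s t}"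
      using s by (intro Collect_cong) (auto simp: cut_def)
    finally show ?thesis .
  qed
  have less_rk: "b < ?rk s \<longleftrightarrow> (\<exists>t\<in>?F. strict_prefix s t \<and> b \<le> ?rk t)" if s: "s \<in> ?F" for s b
    unfolding rec[OF s] less_osup_iff[OF small] using less_osucc_iff by fastforce
  define res where "res s = {y \<in> A. \<forall>x\<in>set s. Q x y}" for s
  have res_snoc: "{y \<in> res s. Q x y} = res (s @ [x])" for s x by (auto simp: res_def)
  have child: "s @ [x] \<in> ?F" if "s \<in> ?F \<or> s = []" "x \<in> res s" for s x
    using that by (auto simp: seqs_def res_def sorted_wrt_append)
  \<comment> \<open>Every proper extension of \<open>s\<close> passes through a one-element
    extension of at least the same rank, so ranks may be compared along single moves.\<close>
  have descend: "\<exists>x\<in>res s. s @ [x] \<in> ?F \<and> ?rk t \<le> ?rk (s @ [x])" if t: "t \<in> ?F" "strict_prefix s t" for s t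
  proof -
    obtain x ys where t_eq: "t = s @ x # ys" using t(2) by (auto elim: strict_prefixE')
    have "s @ [x] \<in> ?F" "x \<in> res s"
      using t(1) unfolding t_eq by (auto simp: seqs_def res_def sorted_wrt_append)
    moreover have "?rk t \<le> ?rk (s @ [x])"
    proof (cases "ys = []")
      case False
      then have "strict_prefix (s @ [x]) t" by (auto simp: t_eq strict_prefix_def)
      then have "?rk t < ?rk (s @ [x])" using less_rk[OF \<open>s @ [x] \<in> ?F\<close>, of "?rk t"] t(1) by blast
      then show ?thesis by (rule less_imp_le)
    qed (simp add: t_eq)
    ultimately show ?thesis by blast
  qed
  have node: "has_rank Q (res s) (?rk s)" if "s \<in> ?F" for s
    using that
  proof (induction s rule: wf_induct_rule[OF wf])
    case (1 s)
    have IH: "has_rank Q (res (s @ [x])) (?rk (s @ [x]))" if "x \<in> res s" for x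
      using child[of s x] that 1 by (simp add: strict_prefix_def)
    have "rank_le Q (res s) (?rk s)"
    proof (rule rank_leI)
      fix x assume x: "x \<in> res s"
      then have "?rk (s @ [x]) < ?rk s"
        using less_rk[OF 1(2)] child[of s x] 1(2) strict_prefixI'[of "s @ [x]" s x "[]"] by blast
      then show "\<exists>b<?rk s. rank_le Q {y \<in> res s. Q x y} b"
        using IH[OF x] unfolding res_snoc has_rank_def by blast
    qed
    moreover have "rank_ge Q (res s) (?rk s)"
    proof (rule rank_geI)
      fix b assume "b < ?rk s"
      then obtain t where t: "t \<in> ?F" "strict_prefix s t" "b \<le> ?rk t" using less_rk[OF 1(2)] by blast
      then obtain x where x: "x \<in> res s" "b \<le> ?rk (s @ [x])" using descend[OF t(1,2)] by force
      then have "rank_ge Q {y \<in> res s. Q x y} b"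
        using IH[OF x(1)] rank_ge_mono unfolding res_snoc has_rank_def by blast
      then show "\<exists>x\<in>res s. rank_ge Q {y \<in> res s. Q x y} b" using x(1) by blast
    qed
    ultimately show ?case by (simp add: has_rank_def)
  qed
  \<comment> \<open>\<open>forest_rank\<close> acts as the rank of the empty sequence, which is
    absent from the forest and has residual \<open>A\<close>.\<close>
  have less_forest: "b < forest_rank ?F \<longleftrightarrow> (\<exists>t\<in>?F. b \<le> ?rk t)" for b :: "'x ordinal"
    unfolding forest_rank_def less_osup_iff[OF small] using less_osucc_iff by fastforce
  have root: "res [] = A" by (simp add: res_def)
  have "rank_le Q A (forest_rank ?F :: 'x ordinal)"
  proof (rule rank_leI)
    fix x assume "x \<in> A"
    then have x: "[x] \<in> ?F" using child[of "[]" x] root by simp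
    then have "?rk [x] < forest_rank ?F" using less_forest by blast
    moreover have "rank_le Q {y \<in> A. Q x y} (?rk [x])"
      using node[OF x] res_snoc[of "[]" x] root by (simp add: has_rank_def)
    ultimately show "\<exists>b<forest_rank ?F. rank_le Q {y \<in> A. Q x y} (b :: 'x ordinal)" by blast
  qed
  moreover have "rank_ge Q A (forest_rank ?F :: 'x ordinal)"
  proof (rule rank_geI)
    fix b :: "'x ordinal" assume "b < forest_rank ?F"
    then obtain t where t: "t \<in> ?F" "b \<le> ?rk t" using less_forest by blast
    then have "strict_prefix [] t" by (auto simp: seqs_def strict_prefix_def)
    then obtain x where x: "x \<in> A" "[x] \<in> ?F" "b \<le> ?rk [x]"
      using descend[OF t(1), of "[]"] t(2) root by force
    have "rank_ge Q {y \<in> A. Q x y} (?rk [x])"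
      using node[OF x(2)] res_snoc[of "[]" x] root by (simp add: has_rank_def)
    then have "rank_ge Q {y \<in> A. Q x y} b" using x(3) by (rule rank_ge_mono[OF _ subset_refl])
    then show "\<exists>x\<in>A. rank_ge Q {y \<in> A. Q x y} b" using x(1) by blast
  qed
  ultimately show ?thesis by (simp add: has_rank_def)
qed

lemma fold_natural_prod:
  fixes f :: "nat \<Rightarrow> 'x::infinite ordinal"
  assumes "1 \<le> n"
  shows "fold (\<lambda>k acc. natural_prod acc (f k)) [2..<Suc n] (f 1) = (\<Prod>k\<in>{1..n}. f k)"
  using assms
proof (induction n rule: dec_induct)
  case (step n)
  then have "[2..<Suc (Suc n)] = [2..<Suc n] @ [Suc n]" by simp
  then show ?case using step by (simp add: times_ordinal_def[symmetric] mult.commute)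
qed simp

theorem mainTheorem15:
  fixes n :: nat and A :: "nat \<Rightarrow> 'a set" and le :: "nat \<Rightarrow> 'a \<Rightarrow> 'a \<Rightarrow> bool"
  assumes wqo: "\<forall>k\<in>{1..n}. wqo_on (A k) (le k)"
    and indec: "\<exists>i\<in>{1..n}. infinite_indecomposable (wqo_mot (A i) (le i) :: 'a big_ordinal)"
    and expinf: "\<exists>j1\<in>{1..n}. \<exists>j2\<in>{1..n}. j1 \<noteq> j2 \<and>
        all_cnf_exponents_infinite (wqo_mot (A j1) (le j1) :: 'a big_ordinal) \<and>
        all_cnf_exponents_infinite (wqo_mot (A j2) (le j2) :: 'a big_ordinal)"
  shows "(wqo_width (Pi\<^sub>E {1..n} A) (prod_le {1..n} le) :: 'a big_ordinal) =
         fold (\<lambda>k acc. natural_prod acc (wqo_mot (A k) (le k))) [2..<Suc n] (wqo_mot (A 1) (le 1))"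
proof -
  let ?I = "{1..n}"
  let ?P = "Pi\<^sub>E ?I A"
  let ?N = "incomp (prod_le ?I le)"
  define a :: "nat \<Rightarrow> 'a big_ordinal" where "a k = wqo_mot (A k) (le k)" for k
  have card: "|UNIV :: (nat \<Rightarrow> 'a) list set| \<le>o |UNIV :: ((nat \<Rightarrow> 'a) list \<times> nat) set|"
    by (rule card_of_ordLeqI[of "\<lambda>xs. (xs, 0)"]) (auto simp: inj_on_def)
  \<comment> \<open>Entries become constant functions, so one ordinal type serves both the factors
    and their product.\<close>
  have "|UNIV :: 'a list set| \<le>o |UNIV :: (nat \<Rightarrow> 'a) list set|"
    by (rule card_of_ordLeqI[of "map (\<lambda>x k. x)"]) (auto intro: inj_onI simp: inj_map_eq_map inj_def fun_eq_iff)
  then have card': "|UNIV :: 'a list set| \<le>o |UNIV :: ((nat \<Rightarrow> 'a) list \<times> nat) set|"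
    using card ordLeq_transitive by blast
  have trans: "transp_on (A k) (le k)" if "k \<in> ?I" for k
    using wqo that unfolding wqo_on_def qo_on_def by (intro transp_onI) blast
  have rank: "has_rank (nle (le k)) (A k) (a k)" if "k \<in> ?I" for k
    unfolding a_def wqo_mot_def bad_seqs_eq
    using wqo that unfolding wqo_on_def by (intro has_rank_forest_rank[OF card']) blast
  \<comment> \<open>Incomparable sequences are bad, so the bound for bad sequences carries
    over.\<close>
  have le: "rank_le ?N ?P (\<Prod>k\<in>?I. a k)"
    using rank_le_prod[of ?I A le a, OF finite_atLeastAtMost trans rank]
    by (rule rank_le_mono) auto
  obtain i where i: "i \<in> ?I" "infinite_indecomposable (a i)" using indec unfolding a_def by blast
  obtain j1 j2 where j: "j1 \<in> ?I" "j2 \<in> ?I" "j1 \<noteq> j2"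
    "all_cnf_exponents_infinite (a j1)" "all_cnf_exponents_infinite (a j2)"
    using expinf unfolding a_def by blast
  have ge: "rank_ge ?N ?P (\<Prod>k\<in>?I. a k)"
    by (rule rank_ge_prod[of ?I A le a i j1 j2, OF finite_atLeastAtMost trans rank i j])
  have "has_rank ?N ?P (wqo_width ?P (prod_le ?I le) :: 'a big_ordinal)"
    unfolding wqo_width_def antichain_seqs_eq
    by (rule has_rank_forest_rank[of ?P ?N, OF card rank_le_no_infinite[OF le]])
  then have "(wqo_width ?P (prod_le ?I le) :: 'a big_ordinal) = (\<Prod>k\<in>?I. a k)"
    using le ge by (rule has_rank_unique)
  also have "\<dots> = fold (\<lambda>k acc. natural_prod acc (a k)) [2..<Suc n] (a 1)"
    using i(1) by (intro fold_natural_prod[symmetric]) simp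
  finally show ?thesis unfolding a_def .
qed

end
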